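(* Let $d\ge2$. Let $(\mathcal{D}_N)$ be a sequence of partitions of $\mathbb{S}^d$ into $N$ equal area subsets $D_{j,N}$, $j=1,\dots,N$, such that $\operatorname{diam}D_{j,N}\le c/N^{1/d}$, where $c$ is a positive constant independent of $j$ and $N$. Let $X_N=\{\mathbf{x}_{1,N},\dots,\mathbf{x}_{N,N}\}$, where $\mathbf{x}_{j,N}$ is chosen randomly from $D_{j,N}$ with respect to uniform measure on $D_{j,N}$ (independently for different $j$). Then for $s>d/2+1$ with $2s-d$ not an even integer, $$\sqrt{\mathbb{E}\big[\{\operatorname{wce}(Q[X_N];\mathbb{H}^s(\mathbb{S}^d))\}^2\big]}\ge\frac{\beta}{N^{(d/2+1)/d}},$$ where $\beta>0$ depends on the $\mathbb{H}^s(\mathbb{S}^d)$-norm and $(\mathcal{D}_N)$, but is independent of $N$.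
   Context: $\mathbb{S}^d$ is the unit sphere in $\mathbb{R}^{d+1}$, $d\ge 2$, and $\sigma_d$ is its normalized surface measure ($\sigma_d(\mathbb{S}^d)=1$). A partition of $\mathbb{S}^d$ into $N$ equal area subsets means measurable sets $D_{1,N},\dots,D_{N,N}$ with $\bigcup_jD_{j,N}=\mathbb{S}^d$, $\sigma_d(D_{j,N}\cap D_{k,N})=0$ for $j\ne k$, and $\sigma_d(D_{j,N})=1/N$. The uniform measure on $D_{j,N}$ is $\mu_{j,N}=\sigma_d|_{D_{j,N}}/\sigma_d(D_{j,N})$; the expectation is with respect to the product measure $\mu_{1,N}\times\cdots\times\mu_{N,N}$. $\operatorname{diam}A=\sup\{|\mathbf{x}-\mathbf{y}|:\mathbf{x},\mathbf{y}\in A\}$ (Euclidean distance). Let $\{Y_{\ell,k}:k=1,\dots,Z(d,\ell)\}$ be an $\mathbb{L}_2(\mathbb{S}^d,\sigma_d)$-orthonormal family of real spherical harmonics of exact degree $\ell$, where $Z(d,\ell)=(2\ell+d-1)\frac{\Gamma(\ell+d-1)}{\Gamma(d)\Gamma(\ell+1)}$, and let $\lambda_\ell=\ell(\ell+d-1)$, $\ell\ge 0$. For $f\in \mathbb{L}_2(\mathbb{S}^d)$ put $\widehat f_{\ell,k}=\int_{\mathbb{S}^d} f\,Y_{\ell,k}\,\mathrm{d}\sigma_d$. For $s>d/2$ the Sobolev space $\mathbb{H}^s(\mathbb{S}^d)$ is the set of $f\in \mathbb{L}_2(\mathbb{S}^d)$ with $\sum_{\ell=0}^\infty\sum_{k=1}^{Z(d,\ell)}(1+\lambda_\ell)^s|\widehat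 f_{\ell,k}|^2<\infty$ (embedded in $C(\mathbb{S}^d)$), with norm $\|f\|_{\mathbb{H}^s}=\big[\sum_{\ell=0}^\infty\sum_{k=1}^{Z(d,\ell)}\frac{1}{a_\ell^{(s)}}|\widehat f_{\ell,k}|^2\big]^{1/2}$, where $(a_\ell^{(s)})_{\ell\ge0}$ is a fixed sequence of positive reals with $a_\ell^{(s)}\asymp(1+\lambda_\ell)^{-s}$. Here $a_n\asymp b_n$ means $c_1a_n\le b_n\le c_2a_n$ for all $n$ with positive constants $c_1,c_2$ independent of $n$. For $X_N=\{\mathbf{x}_1,\dots,\mathbf{x}_N\}\subset\mathbb{S}^d$, let $Q[X_N](f)=\frac1N\sum_{j=1}^Nf(\mathbf{x}_j)$, $I(f)=\int_{\mathbb{S}^d}f\,\mathrm{d}\sigma_d$, and $\operatorname{wce}(Q[X_N];\mathbb{H}^s(\mathbb{S}^d))=\sup\{|Q[X_N](f)-I(f)|:f\in\mathbb{H}^s(\mathbb{S}^d),\ \|f\|_{\mathbb{H}^s}\le1\}$. *)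

theory Defs
  imports "HOL-Analysis.Analysis"
begin

section \<open>Normalized surface measure of the unit sphere\<close>

text \<open>
  The surface measure is given as cone measure: \<open>\<sigma>(A)\<close> is the volume of the cone
  \<open>{t x | 0 < t \<le> 1, x \<in> A}\<close> divided by the volume of the unit ball. It is defined on the Borel
  subsets of the sphere and then completed. The centre of the ball is removed because
  \<open>sgn 0 = 0\<close> is not on the sphere.
\<close>

definition borel_surface_measure :: "'a::euclidean_space measure" where
  "borel_surface_measure =
     distr (restrict_space (uniform_measure lborel (cball 0 1)) (- {0}))
           (restrict_space borel (sphere 0 1)) sgn"

definition surface_measure :: "'a::euclidean_space measure" where
  "surface_measure = completion borel_surface_measure"

lemma emeasure_borel_surface_measure:
  assumes "A \<in> sets borel" "A \<subseteq> sphere (0::'a::euclidean_space) 1"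
  shows "emeasure borel_surface_measure A =
    emeasure lborel {x \<in> cball 0 1. x \<noteq> 0 \<and> sgn x \<in> A} / emeasure lborel (cball (0::'a) 1)"
proof -
  let ?U = "uniform_measure lborel (cball (0::'a) 1)"
  have sgnm: "(sgn :: 'a \<Rightarrow> 'a) \<in> borel_measurable borel"
    unfolding sgn_div_norm[abs_def] by measurable
  have meas: "sgn \<in> restrict_space ?U (- {0}) \<rightarrow>\<^sub>M restrict_space borel (sphere (0::'a) 1)"
  proof (rule measurable_restrict_space2)
    show "sgn \<in> space (restrict_space ?U (- {0})) \<rightarrow> sphere 0 1"
      by (auto simp: space_restrict_space norm_sgn)
    have "(sgn :: 'a \<Rightarrow> 'a) \<in> ?U \<rightarrow>\<^sub>M borel"
      using sgnm by (simp cong: measurable_cong_sets)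
    then show "sgn \<in> restrict_space ?U (- {0}) \<rightarrow>\<^sub>M borel"
      by (rule measurable_restrict_space1)
  qed
  have vim: "sgn -` A \<inter> - {0} \<in> sets (borel :: 'a measure)"
    using measurable_sets[OF sgnm assms(1)] by auto
  have "A \<in> sets (restrict_space borel (sphere (0::'a) 1))"
    using assms by (auto simp: sets_restrict_space)
  then have "emeasure borel_surface_measure A = emeasure (restrict_space ?U (- {0})) (sgn -` A \<inter> - {0})"
    unfolding borel_surface_measure_def
    by (subst emeasure_distr[OF meas]) (auto simp: space_restrict_space)
  also have "\<dots> = emeasure ?U (sgn -` A \<inter> - {0})"
    by (rule emeasure_restrict_space) auto
  also have "\<dots> = emeasure lborel (cball 0 1 \<inter> (sgn -` A \<inter> - {0})) / emeasure lborel (cball (0::'a) 1)"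
    by (rule emeasure_uniform_measure) (use vim in auto)
  also have "cball 0 1 \<inter> (sgn -` A \<inter> - {0}) = {x \<in> cball 0 1. x \<noteq> 0 \<and> sgn x \<in> A}"
    by auto
  finally show ?thesis .
qed

definition equal_area_partition :: "nat \<Rightarrow> (nat \<Rightarrow> 'a::euclidean_space set) \<Rightarrow> bool" where
  "equal_area_partition N D \<longleftrightarrow>
     (\<forall>j\<in>{1..N}. D j \<in> sets surface_measure) \<and>
     (\<Union>j\<in>{1..N}. D j) = sphere 0 1 \<and>
     (\<forall>j\<in>{1..N}. \<forall>k\<in>{1..N}. j \<noteq> k \<longrightarrow> measure surface_measure (D j \<inter> D k) = 0) \<and>
     (\<forall>j\<in>{1..N}. measure surface_measure (D j) = 1 / real N)"


section \<open>Spherical harmonics\<close>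

definition laplacian :: "('a::euclidean_space \<Rightarrow> real) \<Rightarrow> 'a \<Rightarrow> real" where
  "laplacian p x = (\<Sum>b\<in>Basis. (deriv ^^ 2) (\<lambda>t. p (x + t *\<^sub>R b)) 0)"

definition spherical_harmonic :: "nat \<Rightarrow> ('a::euclidean_space \<Rightarrow> real) \<Rightarrow> bool" where
  "spherical_harmonic l y \<longleftrightarrow>
     (\<exists>p. real_polynomial_function p \<and> (\<forall>t x. p (t *\<^sub>R x) = t ^ l * p x) \<and>
          (\<forall>x. laplacian p x = 0) \<and> (\<forall>x\<in>sphere 0 1. y x = p x))"

definition harmonic_dim :: "nat \<Rightarrow> nat \<Rightarrow> nat" where
  "harmonic_dim d l =
     nat \<lfloor>(2 * real l + real d - 1) * Gamma (real l + real d - 1) / (Gamma (real d) * Gamma (real l + 1))\<rfloor>"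

text \<open>Rounding in \<open>harmonic_dim\<close> changes nothing.\<close>

lemma real_harmonic_dim:
  assumes "d \<ge> 2"
  shows "real (harmonic_dim d l) =
    (2 * real l + real d - 1) * Gamma (real l + real d - 1) / (Gamma (real d) * Gamma (real l + 1))"
proof -
  obtain m where d: "d = m + 2" using assms by (metis add.commute le_Suc_ex)
  have "Gamma (real l + real d - 1) = fact (l + m)"
    using Gamma_fact[of "l + m", where 'a = real] d by (simp add: add_ac)
  moreover have "Gamma (real d) = fact (m + 1)"
    using Gamma_fact[of "m + 1", where 'a = real] d by (simp add: add_ac)
  moreover have "Gamma (real l + 1) = fact l"
    using Gamma_fact[of l, where 'a = real] by (simp add: add_ac)
  moreover have "2 * real l + real d - 1 = 2 * real l + real m + 1"
    using d by simp
  ultimately have "(2 * real l + real d - 1) * Gamma (real l + real d - 1) / (Gamma (real d) * Gamma (real l + 1))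
      = (2 * real l + real m + 1) * fact (l + m) / (fact (m + 1) * fact l)"
    by (simp only:)
  also have "\<dots> = real (((l + m + 1) choose (m + 1)) + (if l = 0 then 0 else (l + m) choose (m + 1)))"
  proof (cases l)
    case 0
    have "(fact (m + 1) :: real) = (real m + 1) * fact m" by simp
    moreover have "(fact (m + 1) :: real) \<noteq> 0" by (rule fact_nonzero)
    ultimately have "(real m + 1) * fact m / fact (m + 1) = (1 :: real)" by (metis divide_self)
    then show ?thesis using 0 by (simp del: fact_Suc)
  next
    case (Suc n)
    have "real ((l + m + 1) choose (m + 1)) = fact (l + m + 1) / (fact (m + 1) * fact l)"
      using binomial_fact[of "m + 1" "l + m + 1", where 'a = real] by simp
    also have "\<dots> = (real l + real m + 1) * fact (l + m) / (fact (m + 1) * fact l)"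
      by (simp add: add_ac)
    finally have 1: "real ((l + m + 1) choose (m + 1)) = \<dots>" .
    have "real ((l + m) choose (m + 1)) = fact (l + m) / (fact (m + 1) * fact n)"
      using binomial_fact[of "m + 1" "l + m", where 'a = real] Suc by simp
    also have "\<dots> = real l * fact (l + m) / (fact (m + 1) * fact l)"
      using Suc by simp
    finally have 2: "real ((l + m) choose (m + 1)) = \<dots>" .
    have "real (((l + m + 1) choose (m + 1)) + (if l = 0 then 0 else (l + m) choose (m + 1)))
      = real ((l + m + 1) choose (m + 1)) + real ((l + m) choose (m + 1))"
      using Suc by simp
    also have "\<dots> = (2 * real l + real m + 1) * fact (l + m) / (fact (m + 1) * fact l)"
      unfolding 1 2 add_divide_distrib[symmetric] distrib_right[symmetric] by simp
    finally show ?thesis ..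
  qed
  finally show ?thesis
    by (simp only: harmonic_dim_def floor_of_nat nat_int)
qed

definition orthonormal_harmonics :: "nat \<Rightarrow> (nat \<Rightarrow> nat \<Rightarrow> 'a::euclidean_space \<Rightarrow> real) \<Rightarrow> bool" where
  "orthonormal_harmonics d Y \<longleftrightarrow>
     (\<forall>l. (\<forall>k\<in>{1..harmonic_dim d l}. spherical_harmonic l (Y l k)) \<and>
          (\<forall>k\<in>{1..harmonic_dim d l}. \<forall>k'\<in>{1..harmonic_dim d l}.
             (\<integral>x. Y l k x * Y l k' x \<partial>surface_measure) = (if k = k' then 1 else 0)))"


section \<open>Sobolev spaces\<close>

definition eigenvalue :: "nat \<Rightarrow> nat \<Rightarrow> real" where
  "eigenvalue d l = real l * (real l + real d - 1)"

definition same_order :: "(nat \<Rightarrow> real) \<Rightarrow> (nat \<Rightarrow> real) \<Rightarrow> bool" where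
  "same_order a b \<longleftrightarrow> (\<exists>c1>0. \<exists>c2>0. \<forall>n. c1 * a n \<le> b n \<and> b n \<le> c2 * a n)"

definition fourier_coeff ::
    "(nat \<Rightarrow> nat \<Rightarrow> 'a::euclidean_space \<Rightarrow> real) \<Rightarrow> ('a \<Rightarrow> real) \<Rightarrow> nat \<Rightarrow> nat \<Rightarrow> real" where
  "fourier_coeff Y f l k = (\<integral>x. f x * Y l k x \<partial>surface_measure)"

text \<open>
  Point evaluation is meaningful on the Sobolev space only via its embedding into the continuous
  functions. Its elements are therefore the continuous representatives.
\<close>

definition sobolev_space ::
    "nat \<Rightarrow> (nat \<Rightarrow> nat \<Rightarrow> 'a::euclidean_space \<Rightarrow> real) \<Rightarrow> real \<Rightarrow> ('a \<Rightarrow> real) set" where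
  "sobolev_space d Y s =
     {f. continuous_on (sphere 0 1) f \<and>
         f \<in> borel_measurable surface_measure \<and> integrable surface_measure (\<lambda>x. (f x)\<^sup>2) \<and>
         summable (\<lambda>l. \<Sum>k=1..harmonic_dim d l.
           (1 + eigenvalue d l) powr s * \<bar>fourier_coeff Y f l k\<bar>\<^sup>2)}"

definition sobolev_norm ::
    "nat \<Rightarrow> (nat \<Rightarrow> nat \<Rightarrow> 'a::euclidean_space \<Rightarrow> real) \<Rightarrow> (nat \<Rightarrow> real) \<Rightarrow> ('a \<Rightarrow> real) \<Rightarrow> real" where
  "sobolev_norm d Y a f =
     sqrt (\<Sum>l. \<Sum>k=1..harmonic_dim d l. 1 / a l * \<bar>fourier_coeff Y f l k\<bar>\<^sup>2)"


section \<open>Worst-case error\<close>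

definition cubature :: "nat \<Rightarrow> (nat \<Rightarrow> 'a) \<Rightarrow> ('a \<Rightarrow> real) \<Rightarrow> real" where
  "cubature N X f = 1 / real N * (\<Sum>j=1..N. f (X j))"

definition sphere_integral :: "('a::euclidean_space \<Rightarrow> real) \<Rightarrow> real" where
  "sphere_integral f = (\<integral>x. f x \<partial>surface_measure)"

text \<open>
  The supremum and the expectation of the squared error are taken in \<open>[0, \<infinity>]\<close>, so no
  boundedness or integrability needs to be known in advance.
\<close>

definition wce ::
    "nat \<Rightarrow> (nat \<Rightarrow> nat \<Rightarrow> 'a::euclidean_space \<Rightarrow> real) \<Rightarrow> real \<Rightarrow> (nat \<Rightarrow> real) \<Rightarrow>
     nat \<Rightarrow> (nat \<Rightarrow> 'a) \<Rightarrow> ennreal" where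
  "wce d Y s a N X =
     (SUP f\<in>{f \<in> sobolev_space d Y s. sobolev_norm d Y a f \<le> 1}.
        ennreal \<bar>cubature N X f - sphere_integral f\<bar>)"

definition stratified_sampling :: "nat \<Rightarrow> (nat \<Rightarrow> 'a::euclidean_space set) \<Rightarrow> (nat \<Rightarrow> 'a) measure" where
  "stratified_sampling N D = (\<Pi>\<^sub>M j\<in>{1..N}. uniform_measure surface_measure (D j))"

definition ennsqrt :: "ennreal \<Rightarrow> ennreal" where
  "ennsqrt x = (if x = \<infinity> then \<infinity> else ennreal (sqrt (enn2real x)))"

end

theory Submission
  imports Defs
begin

text \<open>
  A worst-case error is bounded below by the error at any single function of the unit ball, so it is
  enough to have test functions for which a random point set cannot be too accurate. Linear functions
  \<open>x \<mapsto> x \<bullet> b\<close> suffice. Their cubature errors are the components of the vector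
  \<open>(\<Sum>j x\<^sub>j) / N - \<integral> x d\<sigma>\<close>; choosing \<open>b\<close> along that vector, after the points are known, shows that the
  worst-case error is at least its length up to a constant (\<open>wce_ge_distance_of_means\<close>).

  The mean square of this vector is at least \<open>N\<^sup>-\<^sup>2\<close> times the sum of the variances of the independent
  points \<open>x\<^sub>j\<close> (\<open>second_moment_of_sum_ge\<close>). A cell has measure \<open>1 / N\<close>, while a ball of radius \<open>r\<close> meets
  the sphere in measure of order \<open>r ^ d\<close> at most (\<open>surface_measure_ball_le\<close>). With \<open>r\<close> a small multiple of
  \<open>N powr (- 1 / d)\<close> at least half of the cell is therefore at distance \<open>r\<close> or more from any given point,
  and every cell has variance of order \<open>N powr (- 2 / d)\<close> at least. Altogether the mean square is at least
  of order \<open>N powr (- 1 - 2 / d)\<close>, and \<open>(1 + 2 / d) / 2 = (d / 2 + 1) / d\<close>.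

  It remains to see that linear functions belong to the Sobolev space and have bounded norm. This holds
  because they are harmonics of degree 1, hence orthogonal to those of any other degree \<open>l\<close>
  (\<open>fourier_coeff_linear_eq_0\<close>), so that one term remains of the series for the norm. The orthogonality is
  first proved on the ball. For a homogeneous harmonic polynomial \<open>p\<close> of degree \<open>l\<close> put
  \<open>J = \<integral> (x \<bullet> b) p\<close>, the integral being over the unit ball. Integration by parts against the weight
  \<open>1 - x \<bullet> x\<close>, which vanishes on the boundary and has gradient \<open>- 2 x\<close>, gives
  \<open>\<integral> (1 - x \<bullet> x) \<partial>\<^sub>b p = 2 J\<close>. By the same rule and Euler's identity
  \<open>\<Sum>i x\<^sub>i \<partial>\<^sub>i p = l p\<close>, the number \<open>2 l J\<close> is the sum over \<open>i\<close> of
  \<open>\<integral> (1 - x \<bullet> x) \<partial>\<^sub>i ((x \<bullet> b) \<partial>\<^sub>i p)\<close>, which is again \<open>\<integral> (1 - x \<bullet> x) \<partial>\<^sub>b p\<close> as \<open>p\<close> is harmonic. Hence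
  \<open>(l - 1) J = 0\<close>. Homogeneity carries the result over to the sphere
  (\<open>ball_integral_homogeneous_sgn\<close>).
\<close>

section \<open>Integration by parts on the unit ball\<close>

text \<open>
  The direction \<open>h\<close> is the first argument of \<open>g\<close>, so that \<open>g h\<close> is the directional derivative as a function
  of the point, and the lemma can be applied to it once more for second derivatives.
\<close>

lemma real_polynomial_function_derivative:
  assumes "real_polynomial_function p"
  shows "\<exists>g. (\<forall>h. real_polynomial_function (g h)) \<and> (\<forall>x. (p has_derivative (\<lambda>h. g h x)) (at x))"
  using assms
proof induction
  case (linear f)
  then show ?case
    by (intro exI[of _ "\<lambda>h _. f h"]) (auto intro: bounded_linear_imp_has_derivative)
next
  case (const c)
  show ?case by (intro exI[of _ "\<lambda>_ _. 0"]) auto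
next
  case (add p q)
  then obtain g k where "\<forall>h. real_polynomial_function (g h)" "\<forall>x. (p has_derivative (\<lambda>h. g h x)) (at x)"
    "\<forall>h. real_polynomial_function (k h)" "\<forall>x. (q has_derivative (\<lambda>h. k h x)) (at x)" by blast
  then show ?case
    by (intro exI[of _ "\<lambda>h x. g h x + k h x"]) (auto intro: has_derivative_add)
next
  case (mult p q)
  then obtain g k where "\<forall>h. real_polynomial_function (g h)" "\<forall>x. (p has_derivative (\<lambda>h. g h x)) (at x)"
    "\<forall>h. real_polynomial_function (k h)" "\<forall>x. (q has_derivative (\<lambda>h. k h x)) (at x)" by blast
  note gk = this
  show ?case
  proof (intro exI[of _ "\<lambda>h x. p x * k h x + g h x * q x"] conjI allI)
    fix h x
    show "real_polynomial_function (\<lambda>x. p x * k h x + g h x * q x)"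
      by (intro real_polynomial_function.intros(3,4) mult.hyps) (use gk in auto)
    show "((\<lambda>x. p x * q x) has_derivative (\<lambda>h. p x * k h x + g h x * q x)) (at x)"
      by (intro has_derivative_mult) (use gk in auto)
  qed
qed

definition ball_integral :: "('a::euclidean_space \<Rightarrow> real) \<Rightarrow> real" where
  "ball_integral f = (\<integral>x. indicator (cball 0 1) x * f x \<partial>lborel)"

lemma integrable_on_cball:
  fixes f :: "'a::euclidean_space \<Rightarrow> real"
  assumes "continuous_on UNIV f"
  shows "integrable lborel (\<lambda>x. indicator (cball 0 r) x * f x)"
  using borel_integrable_compact[of "cball 0 r" f] assms continuous_on_subset by fastforce

lemma ball_integral_cmult: "ball_integral (\<lambda>x. c * f x) = c * ball_integral f"
  by (simp add: ball_integral_def mult.left_commute)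

lemma ball_integral_sum:
  assumes "\<And>i. i \<in> I \<Longrightarrow> continuous_on UNIV (f i)"
  shows "ball_integral (\<lambda>x. \<Sum>i\<in>I. f i x) = (\<Sum>i\<in>I. ball_integral (f i))"
  using assms by (simp add: ball_integral_def sum_distrib_left integrable_on_cball)

lemma continuous_bounded_on_cball:
  fixes f :: "'a::euclidean_space \<Rightarrow> real"
  assumes "continuous_on UNIV f"
  shows "\<exists>M. \<forall>x. norm x \<le> r \<longrightarrow> \<bar>f x\<bar> \<le> M"
proof -
  have "bounded (f ` cball 0 r)"
    by (intro compact_imp_bounded compact_continuous_image continuous_on_subset[OF assms]) auto
  then obtain M where "\<forall>y\<in>f ` cball 0 r. norm y \<le> M" unfolding bounded_iff by blast
  then have "\<forall>x. norm x \<le> r \<longrightarrow> \<bar>f x\<bar> \<le> M" by auto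
  then show ?thesis ..
qed

lemma AE_norm_neq_1: "AE x::'a::euclidean_space in lborel. norm x \<noteq> 1"
proof -
  have "negligible (sphere (0::'a) 1)" by (rule negligible_sphere)
  then have "sphere (0::'a) 1 \<in> null_sets lborel"
    by (simp add: null_sets_completion_iff negligible_iff_null_sets)
  then show ?thesis by (auto dest!: AE_not_in)
qed

lemma lborel_integral_translate:
  fixes f :: "'a::euclidean_space \<Rightarrow> real"
  assumes "f \<in> borel_measurable borel"
  shows "(\<integral>x. f (x + c) \<partial>lborel) = (\<integral>x. f x \<partial>lborel)"
proof -
  have "(\<integral>x. f x \<partial>lborel) = (\<integral>x. f x \<partial>distr lborel borel ((+) c))"
    by (simp add: lborel_distr_plus)
  also have "\<dots> = (\<integral>x. f (c + x) \<partial>lborel)"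
    using assms by (subst integral_distr) auto
  finally show ?thesis by (simp add: add.commute)
qed

text \<open>
  By translation invariance all difference quotients of \<open>F\<close> have integral zero; the Lipschitz bound makes
  them converge dominatedly. Differentiability almost everywhere is all that is asked for because the weight
  \<open>max 0 (1 - x \<bullet> x)\<close>, to which the lemma is applied, has a kink on the unit sphere.
\<close>

lemma integral_directional_derivative_eq_0:
  fixes F :: "'a::euclidean_space \<Rightarrow> real"
  assumes F: "integrable lborel F" and F': "F' \<in> borel_measurable borel"
    and supp: "\<And>x. norm x > 1 \<Longrightarrow> F x = 0"
    and lip: "\<And>x h. norm x \<le> 2 \<Longrightarrow> \<bar>h\<bar> \<le> 1 \<Longrightarrow> \<bar>F (x + h *\<^sub>R e) - F x\<bar> \<le> L * \<bar>h\<bar>"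
    and e: "norm e \<le> 1"
    and deriv: "AE x in lborel. ((\<lambda>h. F (x + h *\<^sub>R e)) has_real_derivative F' x) (at 0)"
  shows "(\<integral>x. F' x \<partial>lborel) = 0"
proof -
  define t where "t n = 1 / real (Suc n)" for n
  define G where "G n x = (F (x + t n *\<^sub>R e) - F x) / t n" for n x
  have t: "0 < t n" "t n \<le> 1" for n by (auto simp: t_def)
  have tlim: "t \<longlonglongrightarrow> 0" unfolding t_def by (rule LIMSEQ_Suc[OF lim_1_over_n])
  have Fm[measurable]: "F \<in> borel_measurable borel" using F by auto
  have Gm: "G n \<in> borel_measurable lborel" for n
    unfolding G_def by measurable
  have "(\<lambda>n. \<integral>x. G n x \<partial>lborel) \<longlonglongrightarrow> (\<integral>x. F' x \<partial>lborel)"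
  proof (rule integral_dominated_convergence[where w = "\<lambda>x. indicator (cball 0 2) x * L"])
    show "integrable lborel (\<lambda>x::'a. indicator (cball 0 2) x * L)"
      by (rule integrable_on_cball) auto
    show "AE x in lborel. (\<lambda>n. G n x) \<longlonglongrightarrow> F' x"
      using deriv
    proof eventually_elim
      case (elim x)
      then have "((\<lambda>h. (F (x + h *\<^sub>R e) - F x) / h) \<longlongrightarrow> F' x) (at 0)"
        by (simp add: DERIV_def)
      moreover have "filterlim t (at 0) sequentially"
        using tlim t by (auto simp: filterlim_at less_imp_neq[symmetric])
      ultimately show ?case unfolding G_def by (rule filterlim_compose)
    qed
    show "AE x in lborel. norm (G n x) \<le> indicator (cball 0 2) x * L" for n
    proof (rule AE_I2)
      fix x
      show "norm (G n x) \<le> indicator (cball 0 2) x * L"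
      proof (cases "norm x \<le> 2")
        case True
        then show ?thesis using lip[of x "t n"] t[of n]
          by (simp add: G_def abs_divide divide_le_eq mult.commute)
      next
        case False
        \<comment> \<open>Outside the ball of radius 2, the point and its translate are both outside the support.\<close>
        have "norm (t n *\<^sub>R e) \<le> 1" using t[of n] e by (simp add: mult_le_one)
        moreover have "norm x \<le> norm (x + t n *\<^sub>R e) + norm (t n *\<^sub>R e)"
          by (metis add_diff_cancel_right' norm_triangle_ineq4)
        ultimately have "norm (x + t n *\<^sub>R e) > 1" using False by linarith
        then show ?thesis using False supp by (simp add: G_def)
      qed
    qed
  qed (use F' Gm in auto)
  moreover have "(\<integral>x. G n x \<partial>lborel) = 0" for n
  proof -
    have "integrable lborel (\<lambda>x. F (x + t n *\<^sub>R e))"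
      using integrable_distr_eq[of "(+) (t n *\<^sub>R e)" lborel borel F] F
      by (simp add: lborel_distr_plus add.commute)
    then have "(\<integral>x. G n x \<partial>lborel) = ((\<integral>x. F (x + t n *\<^sub>R e) \<partial>lborel) - (\<integral>x. F x \<partial>lborel)) / t n"
      unfolding G_def using F by simp
    then show ?thesis by (simp add: lborel_integral_translate)
  qed
  ultimately show ?thesis by (simp add: LIMSEQ_const_iff)
qed

text \<open>
  The function \<open>q\<close> times \<open>1 - x \<bullet> x\<close>, cut off at the unit sphere, is still Lipschitz, and
  \<open>(1 - x \<bullet> x) q' - 2 (x \<bullet> e) q\<close> is its derivative in direction \<open>e\<close>.
\<close>

lemma ball_integration_by_parts:
  fixes q :: "'a::euclidean_space \<Rightarrow> real"
  assumes q: "continuous_on UNIV q" and q': "continuous_on UNIV q'"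
    and der: "\<And>x. ((\<lambda>h. q (x + h *\<^sub>R e)) has_real_derivative q' x) (at 0)"
    and e: "norm e \<le> 1"
  shows "ball_integral (\<lambda>x. (1 - x \<bullet> x) * q' x) = 2 * ball_integral (\<lambda>x. (x \<bullet> e) * q x)"
proof -
  define W where "W x = max 0 (1 - x \<bullet> x)" for x :: 'a
  define F where "F x = q x * W x" for x
  define F' where "F' x = indicator (cball 0 1) x * ((1 - x \<bullet> x) * q' x - 2 * ((x \<bullet> e) * q x))" for x
  have Wc: "continuous_on UNIV W" unfolding W_def by (intro continuous_intros)
  have W: "W x = (if norm x \<le> 1 then 1 - x \<bullet> x else 0)" for x
    by (auto simp: W_def max_def dot_square_norm power2_eq_square) (smt (verit) mult_le_one norm_ge_zero mult_less_cancel_left2 less_1_mult)+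
  have der': "((\<lambda>h. q (x + h *\<^sub>R e)) has_real_derivative q' (x + h *\<^sub>R e)) (at h)" for x h
  proof -
    have "((\<lambda>k. q ((x + h *\<^sub>R e) + k *\<^sub>R e)) has_real_derivative q' (x + h *\<^sub>R e)) (at (h - h))"
      using der by simp
    moreover have "((\<lambda>k. k - h) has_real_derivative 1) (at h)"
      by (auto intro!: derivative_eq_intros)
    ultimately have "((\<lambda>k. q ((x + h *\<^sub>R e) + (k - h) *\<^sub>R e)) has_real_derivative q' (x + h *\<^sub>R e) * 1) (at h)"
      by (rule DERIV_chain2)
    then show ?thesis by (simp add: algebra_simps)
  qed
  obtain M1 M2 where M1: "\<And>x. norm x \<le> 3 \<Longrightarrow> \<bar>q x\<bar> \<le> M1"
    and M2: "\<And>x. norm x \<le> 3 \<Longrightarrow> \<bar>q' x\<bar> \<le> M2"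
    using continuous_bounded_on_cball[OF q] continuous_bounded_on_cball[OF q'] by metis
  have ball3: "norm (x + h *\<^sub>R e) \<le> 3" if "norm x \<le> 2" "\<bar>h\<bar> \<le> 1" for x h
  proof -
    have "norm (h *\<^sub>R e) \<le> 1" using that e by (simp add: mult_le_one)
    with that(1) norm_triangle_ineq[of x "h *\<^sub>R e"] show ?thesis by linarith
  qed
  have "(\<integral>x. F' x \<partial>lborel) = 0"
  proof (rule integral_directional_derivative_eq_0[where L = "M1 * 5 + M2"])
    have "F = (\<lambda>x. indicator (cball 0 1) x * (q x * W x))"
      by (auto simp: F_def W fun_eq_iff indicator_def)
    then show "integrable lborel F"
      using integrable_on_cball[of "\<lambda>x. q x * W x" 1] continuous_on_mult[OF q Wc] by simp
    have "continuous_on UNIV (\<lambda>x. (1 - x \<bullet> x) * q' x - 2 * ((x \<bullet> e) * q x))"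
      by (intro continuous_intros q q')
    then have "(\<lambda>x. (1 - x \<bullet> x) * q' x - 2 * ((x \<bullet> e) * q x)) \<in> borel_measurable borel"
      by (rule borel_measurable_continuous_onI)
    then show "F' \<in> borel_measurable borel" unfolding F'_def
      by (intro borel_measurable_times borel_measurable_indicator) auto
    show "F x = 0" if "norm x > 1" for x using that by (simp add: F_def W)
    show "norm e \<le> 1" by (rule e)
    show "\<bar>F (x + h *\<^sub>R e) - F x\<bar> \<le> (M1 * 5 + M2) * \<bar>h\<bar>" if x: "norm x \<le> 2" and h: "\<bar>h\<bar> \<le> 1" for x h
    proof -
      let ?y = "x + h *\<^sub>R e"
      have "\<bar>q (x + h *\<^sub>R e) - q (x + 0 *\<^sub>R e)\<bar> \<le> M2 * \<bar>h - 0\<bar>"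
        unfolding real_norm_def[symmetric]
        by (rule field_differentiable_bound[where S = "{-1..1}" and f' = "\<lambda>k. q' (x + k *\<^sub>R e)"])
           (use h in \<open>auto intro!: M2 ball3[OF x] has_field_derivative_at_within[OF der']\<close>)
      then have 1: "\<bar>q ?y - q x\<bar> \<le> M2 * \<bar>h\<bar>" by simp
      have "\<bar>W ?y - W x\<bar> \<le> \<bar>(1 - ?y \<bullet> ?y) - (1 - x \<bullet> x)\<bar>" unfolding W_def by linarith
      also have "\<dots> = \<bar>h * (2 * (x \<bullet> e) + h * (e \<bullet> e))\<bar>"
        by (simp add: algebra_simps inner_commute)
      also have "\<dots> = \<bar>h\<bar> * \<bar>2 * (x \<bullet> e) + h * (e \<bullet> e)\<bar>" by (simp add: abs_mult)
      also have "\<dots> \<le> \<bar>h\<bar> * 5"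
      proof (rule mult_left_mono)
        have "\<bar>x \<bullet> e\<bar> \<le> 2 * 1"
          using Cauchy_Schwarz_ineq2[of x e] mult_mono[OF x e] by simp
        moreover have "\<bar>h * (e \<bullet> e)\<bar> \<le> 1"
          using h e by (auto simp: abs_mult dot_square_norm power_le_one intro!: mult_le_one)
        ultimately show "\<bar>2 * (x \<bullet> e) + h * (e \<bullet> e)\<bar> \<le> 5" by linarith
      qed simp
      finally have 2: "\<bar>W ?y - W x\<bar> \<le> 5 * \<bar>h\<bar>" by simp
      have 3: "\<bar>W x\<bar> \<le> 1" by (simp add: W_def)
      have "F ?y - F x = q ?y * (W ?y - W x) + W x * (q ?y - q x)"
        by (simp add: F_def algebra_simps)
      also have "\<bar>\<dots>\<bar> \<le> \<bar>q ?y\<bar> * \<bar>W ?y - W x\<bar> + \<bar>W x\<bar> * \<bar>q ?y - q x\<bar>"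
        by (metis abs_mult abs_triangle_ineq)
      also have "\<dots> \<le> M1 * (5 * \<bar>h\<bar>) + 1 * (M2 * \<bar>h\<bar>)"
        by (intro add_mono mult_mono 1 2 3 M1 ball3[OF x h]) (use M1[OF ball3[OF x h]] in linarith)+
      finally show ?thesis by (simp add: algebra_simps)
    qed
    show "AE x in lborel. ((\<lambda>h. F (x + h *\<^sub>R e)) has_real_derivative F' x) (at 0)"
      using AE_norm_neq_1
    proof eventually_elim
      case (elim x)
      have cont: "continuous_on UNIV (\<lambda>h. norm (x + h *\<^sub>R e))" by (intro continuous_intros)
      consider "norm x < 1" | "norm x > 1" using elim by linarith
      then show ?case
      proof cases
        case 1
        have "((\<lambda>h. q (x + h *\<^sub>R e) * (1 - (x + h *\<^sub>R e) \<bullet> (x + h *\<^sub>R e))) has_real_derivative F' x) (at 0)"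
          using 1 by (auto simp: F'_def algebra_simps inner_commute intro!: derivative_eq_intros der)
        then show ?thesis
        proof (rule has_field_derivative_transform_within_open)
          show "open {h. norm (x + h *\<^sub>R e) < 1}"
            using cont by (intro open_Collect_less) auto
        qed (use 1 in \<open>auto simp: F_def W\<close>)
      next
        case 2
        have "((\<lambda>h. 0) has_real_derivative F' x) (at 0)"
          using 2 by (auto simp: F'_def)
        then show ?thesis
        proof (rule has_field_derivative_transform_within_open)
          show "open {h. norm (x + h *\<^sub>R e) > 1}"
            using cont by (intro open_Collect_less) auto
        qed (use 2 in \<open>auto simp: F_def W\<close>)
      qed
    qed
  qed
  moreover have "F' x = indicator (cball 0 1) x * ((1 - x \<bullet> x) * q' x) - 2 * (indicator (cball 0 1) x * ((x \<bullet> e) * q x))" for x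
    by (simp add: F'_def algebra_simps)
  moreover have "integrable lborel (\<lambda>x. indicator (cball 0 1) x * ((1 - x \<bullet> x) * q' x))"
    "integrable lborel (\<lambda>x. indicator (cball 0 1) x * ((x \<bullet> e) * q x))"
    by (intro integrable_on_cball continuous_intros q q')+
  ultimately show ?thesis by (simp add: ball_integral_def)
qed

section \<open>Orthogonality of linear functions and harmonics of other degrees\<close>

lemma continuous_on_real_polynomial_function:
  "real_polynomial_function p \<Longrightarrow> continuous_on S p"
  using continuous_on_polymonial_function real_polynomial_function_eq by blast

text \<open>
  The integral \<open>\<integral> (1 - x \<bullet> x) \<partial>\<^sub>b p\<close> over the ball is computed in two ways, as \<open>2 J\<close> and as \<open>2 l J\<close>, where \<open>J\<close> is
  the integral in question: \<open>\<partial>\<^sub>b p\<close> is the derivative of \<open>p\<close> itself, and because of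
  \<open>\<Delta> p = 0\<close> it is also the divergence of the vector field \<open>(x \<bullet> b) \<nabla> p\<close>.
\<close>

lemma ball_integral_linear_times_harmonic:
  fixes p :: "'a::euclidean_space \<Rightarrow> real"
  assumes p: "real_polynomial_function p"
    and hom: "\<And>t x. p (t *\<^sub>R x) = t ^ l * p x"
    and harm: "\<And>x. laplacian p x = 0"
    and b: "norm b \<le> 1" and l: "l \<noteq> 1"
  shows "ball_integral (\<lambda>x. (x \<bullet> b) * p x) = 0"
proof -
  obtain g where gp: "\<And>h. real_polynomial_function (g h)"
    and g: "\<And>x. (p has_derivative (\<lambda>h. g h x)) (at x)"
    using real_polynomial_function_derivative[OF p] by blast
  obtain k where kp: "\<And>i h. real_polynomial_function (k i h)"
    and k: "\<And>i x. (g i has_derivative (\<lambda>h. k i h x)) (at x)"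
    using real_polynomial_function_derivative[OF gp] by metis
  note [continuous_intros] =
    continuous_on_real_polynomial_function[OF p] continuous_on_real_polynomial_function[OF gp]
    continuous_on_real_polynomial_function[OF kp]
  have line: "((\<lambda>h. f (x + h *\<^sub>R i)) has_real_derivative f' i (x + h *\<^sub>R i)) (at h)"
    if f: "\<And>x. (f has_derivative (\<lambda>h. f' h x)) (at x)" for f :: "'a \<Rightarrow> real" and f' x i h
  proof -
    have "((\<lambda>h. x + h *\<^sub>R i) has_derivative (\<lambda>h. h *\<^sub>R i)) (at h)"
      by (auto intro!: derivative_eq_intros)
    then have "((\<lambda>h. f (x + h *\<^sub>R i)) has_derivative (\<lambda>u. f' (u *\<^sub>R i) (x + h *\<^sub>R i))) (at h)"
      by (rule has_derivative_compose) (rule f)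
    moreover have "f' (u *\<^sub>R i) y = u * f' i y" for u y
      using linear_scale[OF has_derivative_linear[OF f]] by (simp add: mult.commute)
    ultimately show ?thesis by (simp add: has_field_derivative_def mult.commute mult_commute_abs)
  qed
  have lap: "(\<Sum>i\<in>Basis. k i i x) = 0" for x
  proof -
    have "(deriv ^^ 2) (\<lambda>t. p (x + t *\<^sub>R i)) 0 = k i i x" for i
    proof -
      have "deriv (\<lambda>t. p (x + t *\<^sub>R i)) = (\<lambda>t. g i (x + t *\<^sub>R i))"
        using DERIV_imp_deriv[OF line[OF g]] by auto
      then show ?thesis
        using DERIV_imp_deriv[OF line[OF k, of i x i 0]] by (simp add: numeral_2_eq_2)
    qed
    then show ?thesis using harm[of x] by (simp add: laplacian_def)
  qed
  have gsum: "g v x = (\<Sum>i\<in>Basis. (v \<bullet> i) * g i x)" for v x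
  proof -
    have lin: "linear (\<lambda>h. g h x)" using has_derivative_linear[OF g] .
    have "g v x = g (\<Sum>i\<in>Basis. (v \<bullet> i) *\<^sub>R i) x" by (simp add: euclidean_representation)
    also have "\<dots> = (\<Sum>i\<in>Basis. (v \<bullet> i) * g i x)"
      by (simp only: linear_sum[OF lin] linear_scale[OF lin] real_scaleR_def)
    finally show ?thesis .
  qed
  \<comment> \<open>Euler's identity: differentiate \<open>h ^ l * p x = p (h x)\<close> at \<open>h = 1\<close>.\<close>
  have euler: "(\<Sum>i\<in>Basis. (x \<bullet> i) * g i x) = l * p x" for x
  proof -
    have "((\<lambda>h. p (0 + h *\<^sub>R x)) has_real_derivative g x (0 + 1 *\<^sub>R x)) (at 1)"
      by (rule line[OF g])
    then have "((\<lambda>h. h ^ l * p x) has_real_derivative g x x) (at 1)" by (simp add: hom)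
    moreover have "((\<lambda>h. h ^ l * p x) has_real_derivative l * p x) (at 1)"
      by (auto intro!: derivative_eq_intros)
    ultimately have "g x x = l * p x" by (rule DERIV_unique)
    then show ?thesis by (simp add: gsum[of x x])
  qed
  have parts: "ball_integral (\<lambda>x. (1 - x \<bullet> x) * ((i \<bullet> b) * g i x + (x \<bullet> b) * k i i x))
      = 2 * ball_integral (\<lambda>x. (x \<bullet> i) * ((x \<bullet> b) * g i x))" if "i \<in> Basis" for i
  proof (rule ball_integration_by_parts)
    show "((\<lambda>h. ((x + h *\<^sub>R i) \<bullet> b) * g i (x + h *\<^sub>R i)) has_real_derivative
       (i \<bullet> b) * g i x + (x \<bullet> b) * k i i x) (at 0)" for x
      using line[OF k, of i x i 0]
      by (auto intro!: derivative_eq_intros simp: inner_add_left)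
  qed (use that in \<open>auto intro!: continuous_intros\<close>)
  have "ball_integral (\<lambda>x. (1 - x \<bullet> x) * g b x)
      = ball_integral (\<lambda>x. \<Sum>i\<in>Basis. (1 - x \<bullet> x) * ((i \<bullet> b) * g i x + (x \<bullet> b) * k i i x))"
    by (simp add: sum_distrib_left[symmetric] sum.distrib lap gsum[of b] inner_commute)
  also have "\<dots> = (\<Sum>i\<in>Basis. 2 * ball_integral (\<lambda>x. (x \<bullet> i) * ((x \<bullet> b) * g i x)))"
    by (subst ball_integral_sum) (auto intro!: continuous_intros simp: parts)
  also have "\<dots> = 2 * ball_integral (\<lambda>x. \<Sum>i\<in>Basis. (x \<bullet> i) * ((x \<bullet> b) * g i x))"
    by (subst ball_integral_sum) (auto intro!: continuous_intros simp: sum_distrib_left)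
  also have "(\<lambda>x. \<Sum>i\<in>Basis. (x \<bullet> i) * ((x \<bullet> b) * g i x)) = (\<lambda>x. l * ((x \<bullet> b) * p x))"
  proof
    fix x
    have "(\<Sum>i\<in>Basis. (x \<bullet> i) * ((x \<bullet> b) * g i x)) = (x \<bullet> b) * (\<Sum>i\<in>Basis. (x \<bullet> i) * g i x)"
      by (simp add: sum_distrib_left mult.left_commute)
    then show "(\<Sum>i\<in>Basis. (x \<bullet> i) * ((x \<bullet> b) * g i x)) = l * ((x \<bullet> b) * p x)"
      by (simp add: euler)
  qed
  finally have "ball_integral (\<lambda>x. (1 - x \<bullet> x) * g b x) = 2 * (l * ball_integral (\<lambda>x. (x \<bullet> b) * p x))"
    by (simp only: ball_integral_cmult)
  moreover have "ball_integral (\<lambda>x. (1 - x \<bullet> x) * g b x) = 2 * ball_integral (\<lambda>x. (x \<bullet> b) * p x)"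
    by (rule ball_integration_by_parts) (use b line[OF g, of _ b 0] in \<open>auto intro!: continuous_intros\<close>)
  ultimately show ?thesis using l by simp
qed

lemma lborel_integral_cball_scale:
  fixes f :: "'a::euclidean_space \<Rightarrow> real"
  assumes f: "f \<in> borel_measurable borel" and r: "0 < r"
  shows "(\<integral>x. indicator (cball 0 r) x * f x \<partial>lborel) = r ^ DIM('a) * ball_integral (\<lambda>x. f (r *\<^sub>R x))"
proof -
  have ind: "indicat_real (cball 0 r) (r *\<^sub>R x) = indicator (cball 0 1) x" for x :: 'a
    using r by (auto simp: indicator_def)
  have m: "(\<lambda>x. indicator (cball 0 r) x * f x) \<in> borel_measurable borel"
    by (intro borel_measurable_times borel_measurable_indicator f) auto
  have "(\<integral>x. indicator (cball 0 r) x * f x \<partial>lborel)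
      = (\<integral>x. indicator (cball 0 r) x * f x \<partial>density (distr lborel borel (\<lambda>x. 0 + r *\<^sub>R x)) (\<lambda>_. ennreal (\<bar>r\<bar> ^ DIM('a))))"
    using r by (subst lborel_affine[of r 0]) (auto simp: ennreal_power)
  also have "\<dots> = (\<integral>x. r ^ DIM('a) * (indicator (cball 0 r) (r *\<^sub>R x) * f (r *\<^sub>R x)) \<partial>lborel)"
    using r m by (subst integral_density) (auto simp: integral_distr)
  finally show ?thesis by (simp add: ind ball_integral_def)
qed

lemma borel_measurable_sgn[measurable]: "(sgn :: 'a::euclidean_space \<Rightarrow> 'a) \<in> borel_measurable borel"
  unfolding sgn_div_norm[abs_def] by measurable

text \<open>
  The value of \<open>g\<close> at \<open>x\<close> is \<open>norm x ^ k * g (sgn x)\<close>. In the shell \<open>r < norm x \<le> 1\<close> the radial factor is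
  within \<open>1 - r ^ k\<close> of 1, so the integrals of \<open>g\<close> and of \<open>g (sgn x)\<close> over the shell differ by at most this
  number times the volume of the shell and a bound for \<open>g\<close> on the ball. By scaling, the first is zero, and the second as well as the
  volume are \<open>1 - r ^ DIM('a)\<close> times their values for the whole ball. After division by this number
  only the factor \<open>1 - r ^ k\<close> is left, which tends to 0 as \<open>r\<close> tends to 1.
\<close>

lemma ball_integral_homogeneous_sgn:
  fixes g :: "'a::euclidean_space \<Rightarrow> real"
  assumes g: "continuous_on UNIV g" and hom: "\<And>t x. g (t *\<^sub>R x) = t ^ k * g x"
    and zero: "ball_integral g = 0"
  shows "ball_integral (\<lambda>x. g (sgn x)) = 0"
proof -
  define n where "n = DIM('a)"
  define V where "V = ball_integral (\<lambda>x::'a. 1)"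
  define I where "I = ball_integral (\<lambda>x. g (sgn x))"
  have [measurable]: "g \<in> borel_measurable borel" using g by (rule borel_measurable_continuous_onI)
  have hm[measurable]: "(\<lambda>x. g (sgn x)) \<in> borel_measurable borel" by measurable
  obtain M where M: "\<And>x. norm x \<le> 1 \<Longrightarrow> \<bar>g x\<bar> \<le> M"
    using continuous_bounded_on_cball[OF g] by blast
  have Msgn: "\<bar>g (sgn x)\<bar> \<le> M" for x by (rule M) (simp add: norm_sgn)
  have M0: "0 \<le> M" using Msgn[of 0] by linarith
  have int1: "integrable lborel (\<lambda>x::'a. indicator (cball 0 r) x * c)" for r c :: real
    by (rule integrable_on_cball) auto
  have inth: "integrable lborel (\<lambda>x. indicator (cball 0 r) x * g (sgn x))" for r
  proof (rule Bochner_Integration.integrable_bound[OF int1[of r M]])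
    show "(\<lambda>x. indicator (cball 0 r) x * g (sgn x)) \<in> borel_measurable lborel"
      by (intro borel_measurable_times borel_measurable_indicator) auto
  qed (use Msgn M0 in \<open>auto simp: indicator_def\<close>)
  have intg: "integrable lborel (\<lambda>x. indicator (cball 0 r) x * g x)" for r
    using g by (rule integrable_on_cball)
  have bound: "\<bar>I\<bar> \<le> M * (1 - r ^ k) * V" if r: "0 < r" "r < 1" for r
  proof -
    define S where "S = cball 0 1 - cball (0::'a) r"
    have indS: "indicat_real S x = indicator (cball 0 1) x - indicator (cball 0 r) x" for x
      using r by (auto simp: S_def indicator_def)
    have shell: "integrable lborel (\<lambda>x. indicator S x * f x)"
       "(\<integral>x. indicator S x * f x \<partial>lborel) = ball_integral f - r ^ n * ball_integral (\<lambda>x. f (r *\<^sub>R x))"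
      if "f \<in> borel_measurable borel" "\<And>r. integrable lborel (\<lambda>x. indicator (cball 0 r) x * f x)" for f
      using that r lborel_integral_cball_scale[of f r]
      by (auto simp: indS left_diff_distrib ball_integral_def n_def)
    have S1: "integrable lborel (\<lambda>x. indicat_real S x)" "(\<integral>x. indicat_real S x \<partial>lborel) = (1 - r ^ n) * V"
      using shell[of "\<lambda>_. 1"] int1[of _ 1] by (auto simp: V_def algebra_simps)
    have "sgn (r *\<^sub>R x) = sgn x" for x :: 'a using r by (simp add: sgn_scaleR)
    then have Sh: "(\<integral>x. indicator S x * g (sgn x) \<partial>lborel) = (1 - r ^ n) * I"
      using shell(2)[OF hm inth] by (simp add: I_def algebra_simps)
    have Sg: "(\<integral>x. indicator S x * g x \<partial>lborel) = 0"
      using shell(2)[OF _ intg] by (simp add: hom ball_integral_cmult zero)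
    have rn: "0 < 1 - r ^ n" using r by (simp add: n_def power_less_one_iff)
    have "(1 - r ^ n) * \<bar>I\<bar> = \<bar>(\<integral>x. indicator S x * g (sgn x) \<partial>lborel) - (\<integral>x. indicator S x * g x \<partial>lborel)\<bar>"
      using rn by (simp add: Sh Sg abs_mult)
    also have "\<dots> = \<bar>\<integral>x. indicator S x * g (sgn x) - indicator S x * g x \<partial>lborel\<bar>"
      using shell(1)[OF hm inth] shell(1)[OF _ intg] by simp
    also have "\<dots> \<le> (\<integral>x. M * (1 - r ^ k) * indicator S x \<partial>lborel)"
      unfolding real_norm_def[symmetric]
    proof (rule Bochner_Integration.integral_norm_bound_integral)
      fix x
      show "norm (indicator S x * g (sgn x) - indicator S x * g x) \<le> M * (1 - r ^ k) * indicator S x"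
      proof (cases "x \<in> S")
        case True
        then have x: "r < norm x" "norm x \<le> 1" by (auto simp: S_def)
        then have "x \<noteq> 0" using r by auto
        then have "g x = g (norm x *\<^sub>R sgn x)" by (simp add: sgn_div_norm)
        then have "g (sgn x) - g x = (1 - norm x ^ k) * g (sgn x)" by (simp add: hom algebra_simps)
        moreover have "norm x ^ k \<le> 1" using x by (simp add: power_le_one)
        moreover have "r ^ k \<le> norm x ^ k" using x r by (intro power_mono) auto
        ultimately show ?thesis
          using Msgn[of x] True M0 by (auto simp: abs_mult mult.commute intro!: mult_mono)
      qed simp
    qed (use S1 shell(1)[OF hm inth] shell(1)[OF _ intg] in auto)
    also have "\<dots> = (1 - r ^ n) * (M * (1 - r ^ k) * V)" using S1 by simp
    finally show ?thesis using rn by (simp add: mult_le_cancel_left_pos)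
  qed
  have "((\<lambda>r. M * (1 - r ^ k) * V) \<longlongrightarrow> M * (1 - 1 ^ k) * V) (at_left (1::real))"
    by (intro tendsto_intros)
  moreover have "eventually (\<lambda>r. \<bar>I\<bar> \<le> M * (1 - r ^ k) * V) (at_left (1::real))"
    using eventually_at_left_real[of 0 1] by (auto elim!: eventually_mono intro!: bound)
  ultimately have "\<bar>I\<bar> \<le> M * (1 - 1 ^ k) * V"
    by (intro tendsto_lowerbound) auto
  then show ?thesis by (simp add: I_def)
qed

section \<open>Normalized surface measure\<close>

lemma space_borel_surface_measure: "space borel_surface_measure = sphere (0::'a::euclidean_space) 1"
  by (simp add: borel_surface_measure_def space_restrict_space)

lemma sets_borel_surface_measure:
  "sets borel_surface_measure = sets (restrict_space borel (sphere (0::'a::euclidean_space) 1))"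
  by (simp add: borel_surface_measure_def)

lemma space_surface_measure: "space surface_measure = sphere (0::'a::euclidean_space) 1"
  by (simp add: surface_measure_def space_borel_surface_measure)

lemma borel_measurable_surface_measure:
  fixes f :: "'a::euclidean_space \<Rightarrow> 'b::topological_space"
  assumes "f \<in> borel_measurable borel"
  shows "f \<in> borel_measurable borel_surface_measure" "f \<in> borel_measurable surface_measure"
proof -
  show "f \<in> borel_measurable borel_surface_measure"
    using measurable_restrict_space1[OF assms]
    by (subst measurable_cong_sets[OF sets_borel_surface_measure refl])
  then show "f \<in> borel_measurable surface_measure"
    unfolding surface_measure_def by (rule measurable_completion)
qed

lemma emeasure_surface_measure_sphere: "emeasure surface_measure (sphere (0::'a::euclidean_space) 1) = 1"
proof -
  let ?B = "cball (0::'a) 1"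
  have "sphere (0::'a) 1 \<in> sets borel_surface_measure"
    by (simp add: sets_borel_surface_measure sets_restrict_space_iff)
  then have "emeasure surface_measure (sphere (0::'a) 1) = emeasure borel_surface_measure (sphere (0::'a) 1)"
    by (simp add: surface_measure_def)
  also have "\<dots> = emeasure lborel {x \<in> ?B. x \<noteq> 0 \<and> sgn x \<in> sphere 0 1} / emeasure lborel ?B"
    by (rule emeasure_borel_surface_measure) auto
  also have "{x \<in> ?B. x \<noteq> 0 \<and> sgn x \<in> sphere 0 1} = ?B - {0}" by (auto simp: norm_sgn)
  also have "emeasure lborel (?B - {0}) = emeasure lborel ?B" by (rule emeasure_Diff_null_set) auto
  also have "emeasure lborel ?B / emeasure lborel ?B = 1"
    by (subst ennreal_divide_self) (auto simp: emeasure_cball unit_ball_vol_pos[THEN less_imp_neq, THEN not_sym])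
  finally show ?thesis .
qed

lemma finite_measure_surface_measure: "finite_measure (surface_measure :: 'a::euclidean_space measure)"
  by (rule finite_measureI) (simp add: space_surface_measure emeasure_surface_measure_sphere)

lemma integrable_surface_measure:
  fixes f :: "'a::euclidean_space \<Rightarrow> 'b::{banach, second_countable_topology}"
  assumes "f \<in> borel_measurable borel" "\<And>x. norm x = 1 \<Longrightarrow> norm (f x) \<le> M"
  shows "integrable surface_measure f"
proof -
  interpret finite_measure "surface_measure :: 'a measure" by (rule finite_measure_surface_measure)
  show ?thesis
    by (rule integrable_const_bound[of _ M])
       (use assms in \<open>auto simp: space_surface_measure intro!: AE_I2 borel_measurable_surface_measure\<close>)
qed

lemma integral_surface_measure:
  fixes f :: "'a::euclidean_space \<Rightarrow> real"
  assumes [measurable]: "f \<in> borel_measurable borel"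
  shows "(\<integral>x. f x \<partial>surface_measure) = ball_integral (\<lambda>x. f (sgn x)) / measure lborel (cball (0::'a) 1)"
proof -
  let ?B = "cball (0::'a) 1"
  let ?U = "uniform_measure lborel ?B"
  let ?V = "measure lborel ?B"
  have V: "emeasure lborel ?B = ennreal ?V" "?V > 0"
    using emeasure_eq_ennreal_measure[of lborel ?B] emeasure_lborel_cball_finite[of "0::'a" 1] by auto
  have "indicator ?B x / ennreal ?V = ennreal (indicator ?B x / ?V)" for x
    using V(2) by (cases "x \<in> ?B") (auto simp: divide_ennreal simp flip: ennreal_1)
  then have U: "?U = density lborel (\<lambda>x. ennreal (indicator ?B x / ?V))"
    by (simp add: uniform_measure_def V(1))
  have sgnm: "sgn \<in> restrict_space ?U (- {0}) \<rightarrow>\<^sub>M restrict_space borel (sphere (0::'a) 1)"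
  proof (rule measurable_restrict_space2)
    show "sgn \<in> restrict_space ?U (- {0}) \<rightarrow>\<^sub>M borel"
      by (rule measurable_restrict_space1) simp
  qed (auto simp: space_restrict_space norm_sgn)
  have "(\<integral>x. f x \<partial>surface_measure) = (\<integral>x. f x \<partial>borel_surface_measure)"
    unfolding surface_measure_def by (rule integral_completion) (rule borel_measurable_surface_measure, simp)
  also have "\<dots> = (\<integral>x. f (sgn x) \<partial>restrict_space ?U (- {0}))"
    unfolding borel_surface_measure_def
    by (rule integral_distr[OF sgnm]) (rule measurable_restrict_space1, simp)
  also have "\<dots> = (\<integral>x. indicator (- {0}) x * f (sgn x) \<partial>?U)"
    by (subst integral_restrict_space) auto
  also have "\<dots> = (\<integral>x. indicator ?B x / ?V * (indicator (- {0}) x * f (sgn x)) \<partial>lborel)"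
    unfolding U
    by (subst integral_density) (auto simp: V(2) less_imp_le intro!: borel_measurable_divide borel_measurable_indicator)
  also have "\<dots> = (\<integral>x. indicator ?B x * f (sgn x) / ?V \<partial>lborel)"
  proof (rule integral_cong_AE)
    show "AE x in lborel. indicator ?B x / ?V * (indicator (- {0}) x * f (sgn x)) = indicator ?B x * f (sgn x) / ?V"
      using AE_lborel_singleton[of "0::'a"] by eventually_elim (auto simp: indicator_def)
  qed (auto intro!: borel_measurable_divide borel_measurable_times borel_measurable_indicator)
  finally show ?thesis by (simp add: ball_integral_def)
qed

text \<open>
  If the ball meets the sphere at \<open>y\<close>, the cone over the intersection stays within \<open>2 / K\<close> of the segment
  from 0 to \<open>y\<close>. The \<open>K + 1\<close> balls of radius \<open>3 / K\<close> centred at the multiples of \<open>y / K\<close> cover it.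
  The bound is of order \<open>K\<close> to the power \<open>- (DIM('a) - 1)\<close>, the right one for radius \<open>1 / K\<close>.
\<close>

lemma surface_measure_ball_le:
  fixes m :: "'a::euclidean_space"
  assumes K: "K \<ge> 1"
  shows "measure surface_measure (sphere 0 1 \<inter> ball m (1 / real K)) \<le> 2 * real K * (3 / real K) ^ DIM('a)"
proof (cases "sphere 0 1 \<inter> ball m (1 / real K) = {}")
  case False
  let ?A = "sphere 0 1 \<inter> ball m (1 / real K)"
  let ?B = "cball (0::'a) 1"
  let ?C = "{x \<in> ?B. x \<noteq> 0 \<and> sgn x \<in> ?A}"
  obtain y where y: "norm y = 1" "dist m y < 1 / real K" using False by auto
  have "emeasure surface_measure ?A = emeasure borel_surface_measure ?A"
    unfolding surface_measure_def
    by (simp add: sets_borel_surface_measure sets_restrict_space_iff)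
  also have "\<dots> = emeasure lborel ?C / emeasure lborel ?B"
    by (rule emeasure_borel_surface_measure) auto
  finally have eq: "emeasure surface_measure ?A = emeasure lborel ?C / emeasure lborel ?B" .
  define T where "T i = cball ((real i / real K) *\<^sub>R y) (3 / real K)" for i
  have "?C \<subseteq> (\<Union>i\<in>{..K}. T i)"
  proof
    fix x assume "x \<in> ?C"
    then have x: "norm x \<le> 1" "x \<noteq> 0" "dist m (sgn x) < 1 / real K" by auto
    define i where "i = nat \<lfloor>norm x * real K\<rfloor>"
    have i: "real i \<le> norm x * real K" "norm x * real K \<le> real i + 1"
      unfolding i_def by (simp_all add: floor_le_iff of_nat_nat)
    have "norm x * real K \<le> 1 * real K" using x(1) by (intro mult_right_mono) auto
    then have "i \<le> K" using i by linarith
    have "norm x - real i / real K = (norm x * real K - real i) / real K"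
      using K by (simp add: field_simps)
    then have i': "\<bar>norm x - real i / real K\<bar> \<le> 1 / real K"
      using i by (simp add: divide_right_mono)
    have "x = norm x *\<^sub>R sgn x" using x(2) by (simp add: sgn_div_norm)
    then have "x - (real i / real K) *\<^sub>R y = norm x *\<^sub>R (sgn x - y) + (norm x - real i / real K) *\<^sub>R y"
      by (simp add: algebra_simps)
    then have "norm (x - (real i / real K) *\<^sub>R y) \<le> norm x * norm (sgn x - y) + \<bar>norm x - real i / real K\<bar> * norm y"
      by (metis norm_triangle_ineq norm_scaleR abs_norm_cancel)
    also have "\<dots> \<le> 1 * (2 / real K) + 1 / real K * 1"
    proof (intro add_mono mult_mono i')
      have "norm (sgn x - y) \<le> dist m (sgn x) + dist m y"
        by (metis dist_commute dist_norm dist_triangle)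
      then show "norm (sgn x - y) \<le> 2 / real K" using x(3) y(2) by linarith
    qed (use x y in auto)
    finally have "x \<in> T i" by (simp add: T_def dist_norm norm_minus_commute)
    then show "x \<in> (\<Union>i\<in>{..K}. T i)" using \<open>i \<le> K\<close> by auto
  qed
  then have "emeasure lborel ?C \<le> emeasure lborel (\<Union>i\<in>{..K}. T i)"
    by (rule emeasure_mono) (auto simp: T_def)
  also have "\<dots> \<le> (\<Sum>i\<in>{..K}. emeasure lborel (T i))"
    by (rule emeasure_subadditive_finite) (auto simp: T_def)
  also have "\<dots> = (\<Sum>i\<in>{..K}. ennreal ((3 / real K) ^ DIM('a)) * emeasure lborel ?B)"
    by (simp add: T_def emeasure_cball ennreal_mult' mult.commute)
  also have "\<dots> = ennreal ((real K + 1) * (3 / real K) ^ DIM('a)) * emeasure lborel ?B"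
    by (simp add: ennreal_mult' mult.assoc ennreal_of_nat_eq_real_of_nat add.commute[of 1] ennreal_plus[symmetric] del: ennreal_plus)
  finally have "emeasure surface_measure ?A
      \<le> ennreal ((real K + 1) * (3 / real K) ^ DIM('a)) * emeasure lborel ?B / emeasure lborel ?B"
    unfolding eq by (rule divide_right_mono_ennreal)
  also have "\<dots> = ennreal ((real K + 1) * (3 / real K) ^ DIM('a))"
    by (subst ennreal_mult_divide_eq) (auto simp: emeasure_cball unit_ball_vol_pos[THEN less_imp_neq, THEN not_sym])
  finally have "measure surface_measure ?A \<le> (real K + 1) * (3 / real K) ^ DIM('a)"
    unfolding measure_def by (rule enn2real_leI[rotated]) simp
  also have "\<dots> \<le> 2 * real K * (3 / real K) ^ DIM('a)"
    using K by (intro mult_right_mono) auto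
  finally show ?thesis .
qed auto

section \<open>Second moments of sums of independent vectors\<close>

text \<open>
  The point \<open>m\<close> is the mean, and the left-hand side bounds the decomposition of a second moment into the
  variance and the squared distance to the mean. A lower bound without the term \<open>(norm (m - c))\<^sup>2\<close> would be
  useless for sums, since it would not add up over the summands.
\<close>

lemma second_moment_ge_variance:
  fixes M :: "'a::euclidean_space measure"
  assumes one: "emeasure M (space M) = 1" and [measurable]: "(\<lambda>x. x) \<in> borel_measurable M"
    and bdd: "\<And>x. x \<in> space M \<Longrightarrow> norm x \<le> 1"
    and spread: "\<And>m. ennreal v \<le> (\<integral>\<^sup>+x. ennreal ((norm (x - m))\<^sup>2) \<partial>M)"
  shows "\<exists>m. \<forall>c. ennreal (v + (norm (m - c))\<^sup>2) \<le> (\<integral>\<^sup>+x. ennreal ((norm (x - c))\<^sup>2) \<partial>M)"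
proof (intro exI allI)
  interpret finite_measure M by (rule finite_measureI) (simp add: one)
  have M1: "measure M (space M) = 1" by (simp add: measure_def one)
  define m where "m = (\<integral>x. x \<partial>M)"
  fix c
  have int: "integrable M (\<lambda>x. x)"
    by (rule integrable_const_bound[of _ 1]) (use bdd in auto)
  have int2: "integrable M (\<lambda>x. (norm (x - a))\<^sup>2)" for a
  proof (rule integrable_const_bound[of _ "(1 + norm a)\<^sup>2"])
    show "AE x in M. norm ((norm (x - a))\<^sup>2) \<le> (1 + norm a)\<^sup>2"
      using bdd by (intro AE_I2) (auto intro!: power_mono norm_triangle_le_diff)
  qed auto
  have nn: "(\<integral>\<^sup>+x. ennreal ((norm (x - a))\<^sup>2) \<partial>M) = ennreal (\<integral>x. (norm (x - a))\<^sup>2 \<partial>M)" for a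
    by (rule nn_integral_eq_integral) (use int2 in auto)
  have expand: "(norm (x - c))\<^sup>2 = (norm (x - m))\<^sup>2 + (2 * ((x - m) \<bullet> (m - c)) + (norm (m - c))\<^sup>2)" for x
    by (simp add: power2_norm_eq_inner algebra_simps inner_commute)
  have "(\<integral>x. (norm (x - c))\<^sup>2 \<partial>M)
      = (\<integral>x. (norm (x - m))\<^sup>2 + (2 * ((x - m) \<bullet> (m - c)) + (norm (m - c))\<^sup>2) \<partial>M)"
    by (rule Bochner_Integration.integral_cong[OF refl expand])
  also have "\<dots> = (\<integral>x. (norm (x - m))\<^sup>2 \<partial>M) + (\<integral>x. 2 * ((x - m) \<bullet> (m - c)) + (norm (m - c))\<^sup>2 \<partial>M)"
    by (rule Bochner_Integration.integral_add) (use int int2 in auto)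
  also have "(\<integral>x. 2 * ((x - m) \<bullet> (m - c)) + (norm (m - c))\<^sup>2 \<partial>M) = (norm (m - c))\<^sup>2"
    using int M1 by (simp add: m_def[symmetric])
  finally have eq: "(\<integral>x. (norm (x - c))\<^sup>2 \<partial>M) = (\<integral>x. (norm (x - m))\<^sup>2 \<partial>M) + (norm (m - c))\<^sup>2" .
  have "v \<le> (\<integral>x. (norm (x - m))\<^sup>2 \<partial>M)"
    using spread[of m] unfolding nn by (subst (asm) ennreal_le_iff) auto
  then show "ennreal (v + (norm (m - c))\<^sup>2) \<le> (\<integral>\<^sup>+x. ennreal ((norm (x - c))\<^sup>2) \<partial>M)"
    unfolding nn eq by (intro ennreal_leI) simp
qed

text \<open>
  Variances of independent vectors add up. Induction over the index set, with \<open>c\<close> arbitrary: integrating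
  over all coordinates but one, with \<open>c\<close> shifted by the last one, leaves a second moment of that coordinate
  about a new point. In this form, with nonnegative integrals, no integrability has to be carried along.
\<close>

lemma (in product_sigma_finite) second_moment_of_sum_ge:
  fixes m :: "'i \<Rightarrow> 'v::euclidean_space"
  assumes "finite J"
    and "\<And>j. j \<in> J \<Longrightarrow> Z j \<in> borel_measurable (M j)"
    and "\<And>j. j \<in> J \<Longrightarrow> emeasure (M j) (space (M j)) = 1"
    and "\<And>j c. j \<in> J \<Longrightarrow> ennreal (v + (norm (m j - c))\<^sup>2) \<le> (\<integral>\<^sup>+x. ennreal ((norm (Z j x - c))\<^sup>2) \<partial>M j)"
    and "0 \<le> v"
  shows "ennreal (real (card J) * v + (norm ((\<Sum>j\<in>J. m j) - c))\<^sup>2)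
    \<le> (\<integral>\<^sup>+X. ennreal ((norm ((\<Sum>j\<in>J. Z j (X j)) - c))\<^sup>2) \<partial>Pi\<^sub>M J M)"
  using assms
proof (induction J arbitrary: c rule: finite_induct)
  case empty
  show ?case by (simp add: PiM_empty nn_integral_count_space_finite)
next
  case (insert i I)
  note [measurable] = insert.prems(1)
  have [measurable]: "(\<lambda>X. Z j (X j)) \<in> borel_measurable (Pi\<^sub>M (insert i I) M)" if "j \<in> insert i I" for j
    using measurable_compose[OF measurable_component_singleton[OF that, of M] insert.prems(1)[OF that]] .
  have [measurable]: "Z i \<in> borel_measurable (M i)" by (rule insert.prems) simp
  let ?m = "\<Sum>j\<in>I. m j"
  have "ennreal (real (card (insert i I)) * v + (norm ((\<Sum>j\<in>insert i I. m j) - c))\<^sup>2)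
      = ennreal (real (card I) * v) + ennreal (v + (norm (m i - (c - ?m)))\<^sup>2)"
    using insert.hyps \<open>0 \<le> v\<close>
    by (simp add: ennreal_plus[symmetric] algebra_simps del: ennreal_plus)
  also have "\<dots> \<le> ennreal (real (card I) * v) + (\<integral>\<^sup>+y. ennreal ((norm (Z i y - (c - ?m)))\<^sup>2) \<partial>M i)"
    by (intro add_left_mono insert.prems) simp
  also have "\<dots> = (\<integral>\<^sup>+y. ennreal (real (card I) * v) + ennreal ((norm (Z i y - (c - ?m)))\<^sup>2) \<partial>M i)"
    by (subst nn_integral_add) (auto simp: insert.prems)
  also have "\<dots> = (\<integral>\<^sup>+y. ennreal (real (card I) * v + (norm (?m - (c - Z i y)))\<^sup>2) \<partial>M i)"
    using \<open>0 \<le> v\<close> by (simp add: ennreal_plus[symmetric] algebra_simps del: ennreal_plus)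
  also have "\<dots> \<le> (\<integral>\<^sup>+y. (\<integral>\<^sup>+X. ennreal ((norm ((\<Sum>j\<in>I. Z j (X j)) - (c - Z i y)))\<^sup>2) \<partial>Pi\<^sub>M I M) \<partial>M i)"
    by (intro nn_integral_mono insert.IH insert.prems) auto
  also have "\<dots> = (\<integral>\<^sup>+y. (\<integral>\<^sup>+X. ennreal ((norm ((\<Sum>j\<in>insert i I. Z j ((X(i := y)) j)) - c))\<^sup>2) \<partial>Pi\<^sub>M I M) \<partial>M i)"
  proof (intro nn_integral_cong)
    fix y X
    have "(\<Sum>j\<in>insert i I. Z j ((X(i := y)) j)) = Z i y + (\<Sum>j\<in>I. Z j (X j))"
      using insert.hyps by (simp add: sum.insert) (intro sum.cong, auto)
    then show "ennreal ((norm ((\<Sum>j\<in>I. Z j (X j)) - (c - Z i y)))\<^sup>2)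
      = ennreal ((norm ((\<Sum>j\<in>insert i I. Z j ((X(i := y)) j)) - c))\<^sup>2)"
      by (simp add: algebra_simps)
  qed
  also have "\<dots> = (\<integral>\<^sup>+X. ennreal ((norm ((\<Sum>j\<in>insert i I. Z j (X j)) - c))\<^sup>2) \<partial>Pi\<^sub>M (insert i I) M)"
    using insert.hyps by (intro product_nn_integral_insert_rev[symmetric]) auto
  finally show ?case .
qed

section \<open>Linear functions in the Sobolev space\<close>

lemma spherical_harmonic_bounded_polynomial:
  assumes "spherical_harmonic l y"
  shows "\<exists>p M. real_polynomial_function p \<and> (\<forall>x. norm x = 1 \<longrightarrow> y x = p x \<and> \<bar>y x\<bar> \<le> M)"
proof -
  obtain p where p: "real_polynomial_function p" "\<forall>x\<in>sphere 0 1. y x = p x"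
    using assms unfolding spherical_harmonic_def by blast
  obtain M where "\<forall>x. norm x \<le> 1 \<longrightarrow> \<bar>p x\<bar> \<le> M"
    using continuous_bounded_on_cball[OF continuous_on_real_polynomial_function[OF p(1)]] by blast
  with p show ?thesis by (intro exI[of _ p] exI[of _ M]) auto
qed

lemma fourier_coeff_linear_eq_0:
  fixes Y :: "nat \<Rightarrow> nat \<Rightarrow> 'a::euclidean_space \<Rightarrow> real"
  assumes Y: "spherical_harmonic l (Y l k)" and l: "l \<noteq> 1" and b: "norm b \<le> 1"
  shows "fourier_coeff Y (\<lambda>x. x \<bullet> b) l k = 0"
proof -
  obtain p where p: "real_polynomial_function p" "\<forall>t x. p (t *\<^sub>R x) = t ^ l * p x"
    "\<forall>x. laplacian p x = 0" "\<forall>x\<in>sphere 0 1. Y l k x = p x"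
    using Y unfolding spherical_harmonic_def by blast
  let ?g = "\<lambda>x. (x \<bullet> b) * p x"
  have cont: "continuous_on UNIV ?g"
    by (intro continuous_intros continuous_on_real_polynomial_function[OF p(1)])
  have "fourier_coeff Y (\<lambda>x. x \<bullet> b) l k = (\<integral>x. ?g x \<partial>surface_measure)"
    unfolding fourier_coeff_def
    by (rule Bochner_Integration.integral_cong) (auto simp: space_surface_measure p(4))
  also have "\<dots> = ball_integral (\<lambda>x. ?g (sgn x)) / measure lborel (cball (0::'a) 1)"
    using cont by (intro integral_surface_measure borel_measurable_continuous_onI)
  also have "ball_integral (\<lambda>x. ?g (sgn x)) = 0"
  proof (rule ball_integral_homogeneous_sgn[OF cont])
    show "(t *\<^sub>R x \<bullet> b) * p (t *\<^sub>R x) = t ^ Suc l * ((x \<bullet> b) * p x)" for t x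
      by (simp add: p(2))
    show "ball_integral ?g = 0"
      using p b l by (intro ball_integral_linear_times_harmonic) auto
  qed
  finally show ?thesis by simp
qed

text \<open>
  Only the Fourier coefficients of degree 1 are nonzero, and they are bounded uniformly for \<open>norm b \<le> 1\<close>
  since harmonics are bounded on the sphere.
\<close>

lemma linear_in_sobolev_unit_ball:
  fixes Y :: "nat \<Rightarrow> nat \<Rightarrow> 'a::euclidean_space \<Rightarrow> real"
  assumes Y: "orthonormal_harmonics d Y" and a: "a 1 > 0"
  shows "\<exists>B\<ge>1. \<forall>b. norm b \<le> 1 / B \<longrightarrow>
    (\<lambda>x. x \<bullet> b) \<in> sobolev_space d Y s \<and> sobolev_norm d Y a (\<lambda>x. x \<bullet> b) \<le> 1"
proof -
  let ?H = "\<lambda>l. {1..harmonic_dim d l}"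
  have sh: "spherical_harmonic l (Y l k)" if "k \<in> ?H l" for l k
    using Y that unfolding orthonormal_harmonics_def by blast
  have "\<exists>M. \<forall>x. norm x = 1 \<longrightarrow> \<bar>Y 1 k x\<bar> \<le> M" if "k \<in> ?H 1" for k
    using spherical_harmonic_bounded_polynomial[OF sh[OF that]] by blast
  then obtain M where M: "\<And>k x. k \<in> ?H 1 \<Longrightarrow> norm x = 1 \<Longrightarrow> \<bar>Y 1 k x\<bar> \<le> M k" by metis
  define Q where "Q = (\<Sum>k\<in>?H 1. 1 / a 1 * (M k)\<^sup>2)"
  \<comment> \<open>One is added so that \<open>B \<ge> 1\<close>, which gives both \<open>Q \<le> B\<^sup>2\<close> and \<open>1 / B \<le> 1\<close>.\<close>
  define B where "B = 1 + Q"
  have "Q \<ge> 0" using a by (auto simp: Q_def intro!: sum_nonneg)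
  then have B: "B \<ge> 1" by (simp add: B_def)
  show ?thesis
  proof (intro exI[of _ B] conjI allI impI B)
    fix b :: 'a assume bB: "norm b \<le> 1 / B"
    have b: "norm b \<le> 1" using bB B by (smt (verit) divide_le_eq_1)
    let ?f = "\<lambda>x. x \<bullet> b"
    have zero: "fourier_coeff Y ?f l k = 0" if "k \<in> ?H l" "l \<noteq> 1" for l k
      by (rule fourier_coeff_linear_eq_0) (use sh that b in auto)
    have bound: "\<bar>fourier_coeff Y ?f 1 k\<bar> \<le> M k / B" if k: "k \<in> ?H 1" for k
    proof -
      obtain p where p: "real_polynomial_function p" "\<And>x. norm x = 1 \<Longrightarrow> Y 1 k x = p x"
        using spherical_harmonic_bounded_polynomial[OF sh[OF k]] by blast
      interpret finite_measure "surface_measure :: 'a measure" by (rule finite_measure_surface_measure)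
      have pt: "\<bar>?f x * p x\<bar> \<le> M k / B" if x: "norm x = 1" for x
      proof -
        have "\<bar>?f x\<bar> \<le> 1 / B" using Cauchy_Schwarz_ineq2[of x b] x bB by simp
        then have "\<bar>?f x * p x\<bar> \<le> 1 / B * M k"
          unfolding abs_mult using M[OF k x] p(2)[OF x] B by (intro mult_mono) auto
        then show ?thesis by simp
      qed
      have "integrable surface_measure (\<lambda>x. ?f x * p x)"
        using pt by (intro integrable_surface_measure[where M = "M k / B"] borel_measurable_continuous_onI
          continuous_intros continuous_on_real_polynomial_function[OF p(1)]) auto
      then have "\<bar>\<integral>x. ?f x * p x \<partial>surface_measure\<bar> \<le> (\<integral>x. M k / B \<partial>(surface_measure :: 'a measure))"
        unfolding real_norm_def[symmetric]
        by (intro Bochner_Integration.integral_norm_bound_integral) (auto simp: space_surface_measure pt)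
      also have "\<dots> = M k / B"
        using emeasure_surface_measure_sphere[where 'a = 'a]
        by (simp add: space_surface_measure measure_def)
      also have "(\<integral>x. ?f x * p x \<partial>surface_measure) = fourier_coeff Y ?f 1 k"
        unfolding fourier_coeff_def
        by (rule Bochner_Integration.integral_cong) (auto simp: space_surface_measure p(2) simp del: One_nat_def)
      finally show ?thesis .
    qed
    have fm: "?f \<in> borel_measurable borel" by (intro borel_measurable_continuous_onI continuous_intros)
    have "\<bar>?f x\<bar> \<le> 1" if "norm x = 1" for x using Cauchy_Schwarz_ineq2[of x b] that b by simp
    then have "(?f x)\<^sup>2 \<le> 1" if "norm x = 1" for x using that by (simp add: abs_square_le_1)
    then have "integrable surface_measure (\<lambda>x. (?f x)\<^sup>2)"
      using fm by (intro integrable_surface_measure[where M = 1]) auto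
    moreover have "summable (\<lambda>l. \<Sum>k=1..harmonic_dim d l. (1 + eigenvalue d l) powr s * \<bar>fourier_coeff Y ?f l k\<bar>\<^sup>2)"
      by (rule summable_finite[of "{1}"]) (auto intro!: sum.neutral simp: zero)
    ultimately show "?f \<in> sobolev_space d Y s"
      using borel_measurable_surface_measure(2)[OF fm]
      by (auto simp: sobolev_space_def intro!: continuous_intros)
    have "(\<Sum>l. \<Sum>k=1..harmonic_dim d l. 1 / a l * \<bar>fourier_coeff Y ?f l k\<bar>\<^sup>2)
        = (\<Sum>l\<in>{1}. \<Sum>k=1..harmonic_dim d l. 1 / a l * \<bar>fourier_coeff Y ?f l k\<bar>\<^sup>2)"
      by (rule suminf_finite) (auto intro!: sum.neutral simp: zero)
    also have "\<dots> = (\<Sum>k\<in>?H 1. 1 / a 1 * \<bar>fourier_coeff Y ?f 1 k\<bar>\<^sup>2)" by simp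
    also have "\<dots> \<le> (\<Sum>k\<in>?H 1. 1 / a 1 * (M k / B)\<^sup>2)"
      by (intro sum_mono mult_left_mono power_mono bound) (use a in auto)
    also have "\<dots> = Q / B\<^sup>2"
      by (simp add: Q_def power_divide sum_divide_distrib)
    also have "\<dots> \<le> 1"
    proof -
      have "Q \<le> B * 1" by (simp add: B_def)
      also have "\<dots> \<le> B * B" using B by (intro mult_left_mono) auto
      finally show ?thesis using B by (simp add: power2_eq_square)
    qed
    finally show "sobolev_norm d Y a ?f \<le> 1" by (simp add: sobolev_norm_def)
  qed
qed

lemma integrable_id_surface_measure: "integrable surface_measure (\<lambda>x::'a::euclidean_space. x)"
  by (rule integrable_surface_measure[where M = 1]) auto

section \<open>The error for random points, one in each cell\<close>

text \<open>
  The test function may depend on the points. The best linear one points in the direction of the error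
  vector.
\<close>

lemma wce_ge_distance_of_means:
  fixes Y :: "nat \<Rightarrow> nat \<Rightarrow> 'a::euclidean_space \<Rightarrow> real"
  assumes B: "B \<ge> 1"
    and test: "\<And>b. norm b \<le> 1 / B \<Longrightarrow> (\<lambda>x. x \<bullet> b) \<in> sobolev_space d Y s \<and> sobolev_norm d Y a (\<lambda>x. x \<bullet> b) \<le> 1"
    and N: "N \<ge> 1"
  shows "ennreal (norm ((\<Sum>j=1..N. X j) - real N *\<^sub>R (\<integral>x. x \<partial>surface_measure)) / (real N * B)) \<le> wce d Y s a N X"
proof -
  let ?m = "\<integral>x. x \<partial>(surface_measure :: 'a measure)"
  let ?u = "(\<Sum>j=1..N. X j) - real N *\<^sub>R ?m"
  let ?b = "(1 / B) *\<^sub>R sgn ?u"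
  let ?f = "\<lambda>x. x \<bullet> ?b"
  have inner_sgn: "w \<bullet> sgn w = norm w" for w :: 'a
    by (cases "w = 0") (simp_all add: sgn_div_norm dot_square_norm power2_eq_square)
  have "cubature N X ?f - sphere_integral ?f = ((1 / real N) *\<^sub>R ?u) \<bullet> ?b"
    using N integrable_id_surface_measure[where 'a = 'a]
    by (simp add: cubature_def sphere_integral_def inner_sum_left inner_diff_left scaleR_diff_right sum_divide_distrib
      del: inner_scaleR_right)
  also have "\<dots> = norm ?u / (real N * B)"
    using inner_sgn by (simp add: mult.commute)
  finally have "ennreal (norm ?u / (real N * B)) = ennreal \<bar>cubature N X ?f - sphere_integral ?f\<bar>"
    using B by simp
  also have "\<dots> \<le> wce d Y s a N X"
    unfolding wce_def
  proof (rule SUP_upper)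
    have "norm ?b \<le> 1 / B" using B by (simp add: norm_sgn)
    then show "?f \<in> {f \<in> sobolev_space d Y s. sobolev_norm d Y a f \<le> 1}" using test by blast
  qed
  finally show ?thesis .
qed

text \<open>
  The condition on \<open>K\<close> makes the ball of radius \<open>1 / K\<close> about \<open>m\<close> cover at most half of the measure \<open>1 / N\<close>
  of the cell. On the other half the integrand is at least \<open>1 / K\<^sup>2\<close>.
\<close>

lemma cell_spread:
  fixes D :: "'a::euclidean_space set"
  assumes D: "D \<in> sets surface_measure" "measure surface_measure D = 1 / real N" and N: "N \<ge> 1"
    and K: "K \<ge> 1" "4 * 3 ^ DIM('a) * real N * real K \<le> real K ^ DIM('a)"
  shows "ennreal (1 / (2 * (real K)\<^sup>2)) \<le> (\<integral>\<^sup>+x. ennreal ((norm (x - m))\<^sup>2) \<partial>uniform_measure surface_measure D)"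
proof -
  interpret finite_measure "surface_measure :: 'a measure" by (rule finite_measure_surface_measure)
  let ?\<mu> = "uniform_measure surface_measure D"
  let ?A = "sphere 0 1 \<inter> ball m (1 / real K)"
  have A: "?A \<in> sets surface_measure"
    unfolding surface_measure_def by (rule sets_completionI_sets) (simp add: sets_borel_surface_measure sets_restrict_space_iff)
  have D0: "emeasure surface_measure D = ennreal (1 / real N)"
    using D(2) by (simp add: emeasure_eq_measure)
  have "1 / (2 * real N) \<le> measure surface_measure D - measure surface_measure ?A"
  proof -
    have "measure surface_measure ?A \<le> 2 * real K * (3 / real K) ^ DIM('a)"
      using K(1) by (rule surface_measure_ball_le)
    also have "\<dots> \<le> 1 / (2 * real N)"
      using K N by (simp add: power_divide field_simps)
    finally show ?thesis using N by (simp add: D(2) field_simps)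
  qed
  also have "\<dots> \<le> measure surface_measure (D - ?A)"
  proof -
    have "measure surface_measure D \<le> measure surface_measure ((D - ?A) \<union> ?A)"
      using D(1) A by (intro finite_measure_mono) auto
    also have "\<dots> \<le> measure surface_measure (D - ?A) + measure surface_measure ?A"
      using D(1) A by (intro measure_Un_le) auto
    finally show ?thesis by simp
  qed
  finally have half: "1 / 2 \<le> measure surface_measure (D - ?A) / measure surface_measure D"
    using N by (simp add: D(2) field_simps)
  have DA: "D - ?A \<in> sets surface_measure" using D(1) A by auto
  have "emeasure ?\<mu> (D - ?A) = emeasure surface_measure (D - ?A) / emeasure surface_measure D"
    using D(1) DA by (subst emeasure_uniform_measure) (auto simp: Int_absorb1)
  also have "\<dots> = ennreal (measure surface_measure (D - ?A) / measure surface_measure D)"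
    using N D(2) by (simp add: emeasure_eq_measure divide_ennreal)
  finally have "ennreal (1 / 2) \<le> emeasure ?\<mu> (D - ?A)"
    using half by (simp add: ennreal_leI del: ennreal_half)
  then have "ennreal ((1 / real K)\<^sup>2) * ennreal (1 / 2) \<le> ennreal ((1 / real K)\<^sup>2) * emeasure ?\<mu> (D - ?A)"
    by (intro mult_left_mono) auto
  also have "\<dots> = (\<integral>\<^sup>+x. ennreal ((1 / real K)\<^sup>2) * indicator (D - ?A) x \<partial>?\<mu>)"
    using DA by (subst nn_integral_cmult_indicator) auto
  also have "\<dots> \<le> (\<integral>\<^sup>+x. ennreal ((norm (x - m))\<^sup>2) \<partial>?\<mu>)"
  proof (rule nn_integral_mono)
    fix x assume "x \<in> space ?\<mu>"
    then have x: "norm x = 1" by (simp add: space_surface_measure)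
    show "ennreal ((1 / real K)\<^sup>2) * indicator (D - ?A) x \<le> ennreal ((norm (x - m))\<^sup>2)"
    proof (cases "x \<in> D - ?A")
      case True
      then have "1 / real K \<le> norm (x - m)" using x by (auto simp: dist_norm norm_minus_commute)
      then have "(1 / real K)\<^sup>2 \<le> (norm (x - m))\<^sup>2" by (intro power_mono) auto
      then show ?thesis using True by (simp add: ennreal_leI)
    qed simp
  qed
  also have "ennreal ((1 / real K)\<^sup>2) * ennreal (1 / 2) = ennreal (1 / (2 * (real K)\<^sup>2))"
    by (subst ennreal_mult'[symmetric]) (auto simp: power_divide mult.commute)
  finally show ?thesis .
qed

lemma stratified_second_moment_ge:
  fixes D :: "nat \<Rightarrow> 'a::euclidean_space set"
  assumes D: "equal_area_partition N D" and N: "N \<ge> 1"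
    and K: "K \<ge> 1" "4 * 3 ^ DIM('a) * real N * real K \<le> real K ^ DIM('a)"
  shows "ennreal (real N / (2 * (real K)\<^sup>2))
    \<le> (\<integral>\<^sup>+X. ennreal ((norm ((\<Sum>j=1..N. X j) - c))\<^sup>2) \<partial>stratified_sampling N D)"
proof -
  let ?v = "1 / (2 * (real K)\<^sup>2)"
  \<comment> \<open>Indices outside \<open>{1..N}\<close> get the measure of the first cell, so that all factors are probability measures.\<close>
  define \<mu> where "\<mu> j = uniform_measure surface_measure (D (if j \<in> {1..N} then j else 1))" for j
  have Dj: "D j \<in> sets surface_measure" "measure surface_measure (D j) = 1 / real N" if "j \<in> {1..N}" for j
    using D that by (auto simp: equal_area_partition_def)
  interpret S: finite_measure "surface_measure :: 'a measure" by (rule finite_measure_surface_measure)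
  have one: "emeasure (\<mu> j) (space (\<mu> j)) = 1" for j
  proof -
    define i where "i = (if j \<in> {1..N} then j else 1)"
    have "i \<in> {1..N}" using N by (auto simp: i_def)
    note i = Dj[OF this]
    have e: "emeasure surface_measure (D i) \<noteq> 0" "emeasure surface_measure (D i) < top"
      using i N by (auto simp: S.emeasure_eq_measure)
    have "D i \<inter> space surface_measure = D i" using sets.sets_into_space[OF i(1)] by auto
    then show ?thesis
      using i(1) e unfolding \<mu>_def i_def[symmetric]
      by (simp add: emeasure_uniform_measure ennreal_divide_self)
  qed
  interpret P: product_sigma_finite \<mu>
  proof (rule product_sigma_finite.intro)
    fix j
    interpret finite_measure "\<mu> j" by (rule finite_measureI) (simp add: one)
    show "sigma_finite_measure (\<mu> j)" by unfold_locales
  qed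
  have meas: "(\<lambda>x. x) \<in> borel_measurable (\<mu> j)" for j
  proof -
    have "(\<lambda>x::'a. x) \<in> borel_measurable surface_measure" by (rule borel_measurable_surface_measure) simp
    then show ?thesis unfolding \<mu>_def by (simp cong: measurable_cong_sets)
  qed
  have "\<exists>m. \<forall>c. ennreal (?v + (norm (m - c))\<^sup>2) \<le> (\<integral>\<^sup>+x. ennreal ((norm (x - c))\<^sup>2) \<partial>\<mu> j)" if j: "j \<in> {1..N}" for j
  proof (rule second_moment_ge_variance[OF one meas])
    show "norm x \<le> 1" if "x \<in> space (\<mu> j)" for x
      using that by (simp add: \<mu>_def space_surface_measure)
    show "ennreal ?v \<le> (\<integral>\<^sup>+x. ennreal ((norm (x - m))\<^sup>2) \<partial>\<mu> j)" for m
      using cell_spread[OF Dj[OF j] N K] j by (simp add: \<mu>_def)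
  qed
  then have "\<forall>j\<in>{1..N}. \<exists>m. \<forall>c. ennreal (?v + (norm (m - c))\<^sup>2) \<le> (\<integral>\<^sup>+x. ennreal ((norm (x - c))\<^sup>2) \<partial>\<mu> j)"
    by blast
  from bchoice[OF this] obtain m where m: "\<And>j c. j \<in> {1..N} \<Longrightarrow>
      ennreal (?v + (norm (m j - c))\<^sup>2) \<le> (\<integral>\<^sup>+x. ennreal ((norm (x - c))\<^sup>2) \<partial>\<mu> j)" by blast
  have "ennreal (real N / (2 * (real K)\<^sup>2)) \<le> ennreal (real (card {1..N}) * ?v + (norm ((\<Sum>j\<in>{1..N}. m j) - c))\<^sup>2)"
    by (intro ennreal_leI) simp
  also have "\<dots> \<le> (\<integral>\<^sup>+X. ennreal ((norm ((\<Sum>j\<in>{1..N}. X j) - c))\<^sup>2) \<partial>Pi\<^sub>M {1..N} \<mu>)"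
    by (rule P.second_moment_of_sum_ge) (use meas one m in auto)
  also have "Pi\<^sub>M {1..N} \<mu> = stratified_sampling N D"
    unfolding stratified_sampling_def by (rule PiM_cong) (auto simp: \<mu>_def)
  finally show ?thesis .
qed

lemma ennsqrt_ge:
  assumes "ennreal (r\<^sup>2) \<le> x" "0 \<le> r"
  shows "ennreal r \<le> ennsqrt x"
proof (cases x)
  case (real u)
  then have "r\<^sup>2 \<le> u" using assms by simp
  then have "r \<le> sqrt u" by (rule real_le_rsqrt)
  then show ?thesis using real by (simp add: ennsqrt_def ennreal_leI)
qed (simp add: ennsqrt_def)

theorem theorem25:
  fixes d :: nat and s c :: real and a :: "nat \<Rightarrow> real"
    and Y :: "nat \<Rightarrow> nat \<Rightarrow> 'a::euclidean_space \<Rightarrow> real"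
    and D :: "nat \<Rightarrow> nat \<Rightarrow> 'a set"
  assumes "d \<ge> 2" and "DIM('a) = d + 1"
    and "orthonormal_harmonics d Y"
    and "\<And>N. N \<ge> 1 \<Longrightarrow> equal_area_partition N (D N)"
    and "c > 0"
    and "\<And>N j. N \<ge> 1 \<Longrightarrow> j \<in> {1..N} \<Longrightarrow> diameter (D N j) \<le> c / real N powr (1 / real d)"
    and "s > real d / 2 + 1"
    and "\<not> (\<exists>m::int. 2 * s - real d = 2 * real_of_int m)"
    and "\<And>l. a l > 0"
    and "same_order a (\<lambda>l. (1 + eigenvalue d l) powr (- s))"
  shows "\<exists>\<beta>>0. \<forall>N\<ge>1.
    ennsqrt (\<integral>\<^sup>+ X. (wce d Y s a N X)\<^sup>2 \<partial>stratified_sampling N (D N))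
      \<ge> ennreal (\<beta> / real N powr ((real d / 2 + 1) / real d))"
proof -
  have d: "real d > 0" using assms(1) by simp
  obtain B where B: "B \<ge> 1" and test: "\<And>b. norm b \<le> 1 / B \<Longrightarrow>
      (\<lambda>x. x \<bullet> b) \<in> sobolev_space d Y s \<and> sobolev_norm d Y a (\<lambda>x. x \<bullet> b) \<le> 1"
    using linear_in_sobolev_unit_ball[where a = a and s = s, OF assms(3) assms(9)] by blast
  define C :: real where "C = (4 * 3 ^ (d + 1)) powr (1 / real d)"
  define \<beta> where "\<beta> = 1 / (B * (2 * C) * sqrt 2)"
  have C: "C > 0" by (simp add: C_def)
  have "\<beta> > 0" using B C by (simp add: \<beta>_def)
  moreover have "ennsqrt (\<integral>\<^sup>+ X. (wce d Y s a N X)\<^sup>2 \<partial>stratified_sampling N (D N))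
      \<ge> ennreal (\<beta> / real N powr ((real d / 2 + 1) / real d))" if N: "N \<ge> 1" for N
  proof (rule ennsqrt_ge)
    \<comment> \<open>The real number \<open>z\<close> solves the condition on \<open>K\<close> in \<open>cell_spread\<close> with equality;
      rounding up loses at most a factor 2.\<close>
    define z where "z = C * real N powr (1 / real d)"
    define K where "K = nat \<lceil>z\<rceil>"
    have "(1::real) \<le> 3 ^ (d + 1)" by (rule one_le_power) simp
    then have "1 \<le> C" unfolding C_def using d by (intro ge_one_powr_ge_zero) auto
    moreover have "1 \<le> real N powr (1 / real d)" using N d by (intro ge_one_powr_ge_zero) auto
    ultimately have z1: "1 \<le> z" unfolding z_def using mult_mono[of 1 C 1] by fastforce
    then have Kz: "z \<le> real K" "real K \<le> 2 * z" "K \<ge> 1"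
      unfolding K_def by linarith+
    have "z ^ d = (4 * 3 ^ (d + 1)) * real N"
      using d N by (simp add: z_def C_def power_mult_distrib powr_power)
    then have "4 * 3 ^ (d + 1) * real N \<le> real K ^ d"
      using power_mono[OF Kz(1), of d] z1 by simp
    then have "4 * 3 ^ (d + 1) * real N * real K \<le> real K ^ d * real K"
      by (intro mult_right_mono) auto
    then have Kcond: "4 * 3 ^ DIM('a) * real N * real K \<le> real K ^ DIM('a)"
      by (simp add: assms(2) mult.commute)
    let ?m = "real N *\<^sub>R (\<integral>x. x \<partial>(surface_measure :: 'a measure))"
    let ?q = "\<lambda>X. ennreal ((norm ((\<Sum>j=1..N. X j) - ?m))\<^sup>2)"
    let ?r = "1 / (real N * B)\<^sup>2"
    have "\<beta> / real N powr ((real d / 2 + 1) / real d) = 1 / (B * (2 * z) * sqrt (2 * real N))"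
    proof -
      have "(real d / 2 + 1) / real d = 1 / real d + 1 / 2" using d by (simp add: field_simps)
      then have "real N powr ((real d / 2 + 1) / real d) = real N powr (1 / real d) * sqrt (real N)"
        by (simp add: powr_add powr_half_sqrt)
      then show ?thesis by (simp add: \<beta>_def z_def real_sqrt_mult)
    qed
    then have "(\<beta> / real N powr ((real d / 2 + 1) / real d))\<^sup>2 = 1 / (B\<^sup>2 * (2 * z)\<^sup>2 * (2 * real N))"
      by (simp add: power_mult_distrib power_divide)
    also have "\<dots> \<le> 1 / (B\<^sup>2 * (real K)\<^sup>2 * (2 * real N))"
      using B N Kz by (intro divide_left_mono mult_right_mono mult_left_mono power_mono mult_pos_pos zero_less_power) auto
    also have "\<dots> = ?r * (real N / (2 * (real K)\<^sup>2))"
      using N B by (simp add: field_simps power2_eq_square)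
    finally have "ennreal ((\<beta> / real N powr ((real d / 2 + 1) / real d))\<^sup>2) \<le> ennreal ?r * ennreal (real N / (2 * (real K)\<^sup>2))"
      by (subst ennreal_mult'[symmetric]) (auto intro!: ennreal_leI)
    also have "\<dots> \<le> ennreal ?r * (\<integral>\<^sup>+X. ?q X \<partial>stratified_sampling N (D N))"
      by (intro mult_left_mono stratified_second_moment_ge assms(4) N Kz Kcond) simp
    also have "\<dots> \<le> (\<integral>\<^sup>+X. ennreal ?r * ?q X \<partial>stratified_sampling N (D N))"
    proof (rule eq_refl, rule nn_integral_cmult[symmetric])
      have "(\<lambda>X. X j) \<in> borel_measurable (stratified_sampling N (D N))" if j: "j \<in> {1..N}" for j
      proof -
        have "(\<lambda>x::'a. x) \<in> borel_measurable (uniform_measure surface_measure (D N j))"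
          using borel_measurable_surface_measure(2)[of "\<lambda>x::'a. x"] by (simp cong: measurable_cong_sets)
        from measurable_compose[OF measurable_component_singleton[OF j, of "\<lambda>j. uniform_measure surface_measure (D N j)"] this]
        show ?thesis by (simp add: stratified_sampling_def)
      qed
      then show "?q \<in> borel_measurable (stratified_sampling N (D N))" by measurable
    qed
    also have "\<dots> \<le> (\<integral>\<^sup>+ X. (wce d Y s a N X)\<^sup>2 \<partial>stratified_sampling N (D N))"
    proof (rule nn_integral_mono)
      fix X
      have "ennreal ?r * ?q X = (ennreal (norm ((\<Sum>j=1..N. X j) - ?m) / (real N * B)))\<^sup>2"
        using B N by (simp add: ennreal_mult'[symmetric] ennreal_power power_divide)
      also have "\<dots> \<le> (wce d Y s a N X)\<^sup>2"
        using wce_ge_distance_of_means[OF B test N] by (intro power_mono) auto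
      finally show "ennreal ?r * ?q X \<le> (wce d Y s a N X)\<^sup>2" .
    qed
    finally show "ennreal ((\<beta> / real N powr ((real d / 2 + 1) / real d))\<^sup>2)
      \<le> (\<integral>\<^sup>+ X. (wce d Y s a N X)\<^sup>2 \<partial>stratified_sampling N (D N))" .
  qed (use \<open>\<beta> > 0\<close> in simp)
  ultimately show ?thesis by blast
qed

end
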